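(* Let $G$ be a group and let $\mathbf{k}$ be a (nonzero, not necessarily commutative) ring. Then the category $\mathrm{Rep}_{\mathbf{k}}(\mathbf{FI}_G)$ is noetherian if and only if the group algebra $\mathbf{k}[G^n]$ is left-noetherian for all integers $n \ge 0$.
   Context: A $G$-map $R \to S$ between finite sets is a pair $(f,\rho)$ of functions $f\colon R \to S$ and $\rho\colon R \to G$. The composition of $(f,\rho)\colon R\to S$ followed by $(g,\sigma)\colon S\to T$ is $(g\circ f,\tau)$ with $\tau(x)=\sigma(f(x))\rho(x)$. The category $\mathbf{FI}_G$ has finite sets as objects and as morphisms the $G$-maps $(f,\rho)$ with $f$ injective. For an essentially small category $\mathcal{C}$ and a ring $\mathbf{k}$, $\mathrm{Rep}_{\mathbf{k}}(\mathcal{C})$ is the abelian category of functors from $\mathcal{C}$ to left $\mathbf{k}$-modules (morphisms are natural transformations). For an object $x$, the principal projective $P_x$ is $P_x(y)=\mathbf{k}[\mathrm{Hom}(x,y)]$, the free left $\mathbf{k}$-module on $\mathrm{Hom}(x,y)$. A representation is finitely generated if it is a quotient of a finite direct sum of principal projectives. A representation is noetherian if every ascending chain of subrepresentations stabilizes. $\mathrm{Rep}_{\mathbf{k}}(\mathcal{C})$ is noetherian if every finitely generated object in it is noetherian. *)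

theory Defs
  imports "HOL-Algebra.Algebra"
begin

section \<open>Categories\<close>

text \<open>\<open>Comp C x y z g f\<close> is the composite of \<open>f : x \<rightarrow> y\<close> followed by \<open>g : y \<rightarrow> z\<close>; the objects
  are arguments because a morphism need not determine its codomain.\<close>

record ('o, 'f) category =
  Obj :: "'o set"
  Arr :: "'o \<Rightarrow> 'o \<Rightarrow> 'f set"
  Ident :: "'o \<Rightarrow> 'f"
  Comp :: "'o \<Rightarrow> 'o \<Rightarrow> 'o \<Rightarrow> 'f \<Rightarrow> 'f \<Rightarrow> 'f"

locale category =
  fixes C :: "('o, 'f) category"
  assumes Ident_closed: "x \<in> Obj C \<Longrightarrow> Ident C x \<in> Arr C x x"
    and Comp_closed: "\<lbrakk>x \<in> Obj C; y \<in> Obj C; z \<in> Obj C; f \<in> Arr C x y; g \<in> Arr C y z\<rbrakk>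
      \<Longrightarrow> Comp C x y z g f \<in> Arr C x z"
    and Comp_Ident_right: "\<lbrakk>x \<in> Obj C; y \<in> Obj C; f \<in> Arr C x y\<rbrakk> \<Longrightarrow> Comp C x x y f (Ident C x) = f"
    and Comp_Ident_left: "\<lbrakk>x \<in> Obj C; y \<in> Obj C; f \<in> Arr C x y\<rbrakk> \<Longrightarrow> Comp C x y y (Ident C y) f = f"
    and Comp_assoc: "\<lbrakk>w \<in> Obj C; x \<in> Obj C; y \<in> Obj C; z \<in> Obj C;
        f \<in> Arr C w x; g \<in> Arr C x y; h \<in> Arr C y z\<rbrakk>
      \<Longrightarrow> Comp C w y z h (Comp C w x y g f) = Comp C w x z (Comp C x y z h g) f"


section \<open>The category of finite sets and injective G-maps\<close>

type_synonym ('x, 'g) gmap = "('x \<Rightarrow> 'x) \<times> ('x \<Rightarrow> 'g)"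

text \<open>Finite sets are the finite subsets of a universe \<open>'x\<close>. Functions on a finite set are extensional
  (\<open>undefined\<close> off their domain), so that distinct pairs are distinct G-maps.\<close>

definition G_maps :: "('g, 'b) monoid_scheme \<Rightarrow> 'x set \<Rightarrow> 'x set \<Rightarrow> ('x, 'g) gmap set" where
  "G_maps G A B = (A \<rightarrow>\<^sub>E B) \<times> (A \<rightarrow>\<^sub>E carrier G)"

definition FI :: "('g, 'b) monoid_scheme \<Rightarrow> ('x set, ('x, 'g) gmap) category" where
  "FI G = \<lparr>
     Obj = {A. finite A},
     Arr = (\<lambda>A B. {(f, \<rho>) \<in> G_maps G A B. inj_on f A}),
     Ident = (\<lambda>A. (\<lambda>a\<in>A. a, \<lambda>a\<in>A. \<one>\<^bsub>G\<^esub>)),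
     Comp = (\<lambda>A B D (g, \<sigma>) (f, \<rho>). (\<lambda>a\<in>A. g (f a), \<lambda>a\<in>A. \<sigma> (f a) \<otimes>\<^bsub>G\<^esub> \<rho> a))\<rparr>"

lemma category_FI:
  assumes "group G"
  shows "category (FI G :: ('x set, ('x, 'g) gmap) category)"
proof -
  interpret group G by fact
  show ?thesis
    apply unfold_locales
    subgoal by (auto simp: FI_def G_maps_def)
    subgoal by (auto simp: FI_def G_maps_def inj_on_def PiE_def Pi_def)
    subgoal by (auto simp: FI_def G_maps_def PiE_def Pi_def extensional_def fun_eq_iff)
    subgoal by (auto simp: FI_def G_maps_def PiE_def Pi_def extensional_def fun_eq_iff) metis+
    subgoal by (auto simp: FI_def G_maps_def PiE_def Pi_def extensional_def fun_eq_iff m_assoc)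
    done
qed


section \<open>Left modules\<close>

text \<open>The library locale \<^locale>\<open>module\<close> demands a commutative ring of scalars. As everywhere
  with the record type of modules, the multiplicative fields of a module are irrelevant.\<close>

locale left_module = R?: ring R + M?: abelian_group M
  for R :: "('k, 'c) ring_scheme" (structure) and M :: "('k, 'm) module" (structure) +
  assumes smult_closed: "\<lbrakk>a \<in> carrier R; x \<in> carrier M\<rbrakk> \<Longrightarrow> a \<odot>\<^bsub>M\<^esub> x \<in> carrier M"
    and smult_l_distr: "\<lbrakk>a \<in> carrier R; b \<in> carrier R; x \<in> carrier M\<rbrakk>
      \<Longrightarrow> (a \<oplus> b) \<odot>\<^bsub>M\<^esub> x = a \<odot>\<^bsub>M\<^esub> x \<oplus>\<^bsub>M\<^esub> b \<odot>\<^bsub>M\<^esub> x"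
    and smult_r_distr: "\<lbrakk>a \<in> carrier R; x \<in> carrier M; y \<in> carrier M\<rbrakk>
      \<Longrightarrow> a \<odot>\<^bsub>M\<^esub> (x \<oplus>\<^bsub>M\<^esub> y) = a \<odot>\<^bsub>M\<^esub> x \<oplus>\<^bsub>M\<^esub> a \<odot>\<^bsub>M\<^esub> y"
    and smult_assoc1: "\<lbrakk>a \<in> carrier R; b \<in> carrier R; x \<in> carrier M\<rbrakk>
      \<Longrightarrow> (a \<otimes> b) \<odot>\<^bsub>M\<^esub> x = a \<odot>\<^bsub>M\<^esub> (b \<odot>\<^bsub>M\<^esub> x)"
    and smult_one: "x \<in> carrier M \<Longrightarrow> \<one> \<odot>\<^bsub>M\<^esub> x = x"

definition linear_maps ::
  "('k, 'c) ring_scheme \<Rightarrow> ('k, 'm) module \<Rightarrow> ('k, 'n) module \<Rightarrow> ('m \<Rightarrow> 'n) set" where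
  "linear_maps R M N = {t \<in> carrier M \<rightarrow> carrier N.
     (\<forall>u\<in>carrier M. \<forall>v\<in>carrier M. t (u \<oplus>\<^bsub>M\<^esub> v) = t u \<oplus>\<^bsub>N\<^esub> t v) \<and>
     (\<forall>a\<in>carrier R. \<forall>u\<in>carrier M. t (a \<odot>\<^bsub>M\<^esub> u) = a \<odot>\<^bsub>N\<^esub> t u)}"

text \<open>The free left module on \<open>S\<close>: finitely supported functions, extended by zero off \<open>S\<close>.\<close>

definition free_module :: "('k, 'c) ring_scheme \<Rightarrow> 's set \<Rightarrow> ('k, 's \<Rightarrow> 'k) module" where
  "free_module R S = \<lparr>
     carrier = {\<phi> \<in> UNIV \<rightarrow> carrier R. finite {s. \<phi> s \<noteq> \<zero>\<^bsub>R\<^esub>} \<and> {s. \<phi> s \<noteq> \<zero>\<^bsub>R\<^esub>} \<subseteq> S},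
     monoid.mult = undefined,
     monoid.one = undefined,
     ring.zero = (\<lambda>s. \<zero>\<^bsub>R\<^esub>),
     ring.add = (\<lambda>\<phi> \<psi> s. \<phi> s \<oplus>\<^bsub>R\<^esub> \<psi> s),
     module.smult = (\<lambda>a \<phi> s. a \<otimes>\<^bsub>R\<^esub> \<phi> s)\<rparr>"


section \<open>Representations of a category\<close>

record ('o, 'f, 'k, 'm) rep =
  RepMod :: "'o \<Rightarrow> ('k, 'm) module"
  RepMap :: "'o \<Rightarrow> 'o \<Rightarrow> 'f \<Rightarrow> 'm \<Rightarrow> 'm"

definition representation ::
  "('o, 'f) category \<Rightarrow> ('k, 'c) ring_scheme \<Rightarrow> ('o, 'f, 'k, 'm) rep \<Rightarrow> bool" where
  "representation C R V \<longleftrightarrow>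
     (\<forall>x\<in>Obj C. left_module R (RepMod V x)) \<and>
     (\<forall>x\<in>Obj C. \<forall>y\<in>Obj C. \<forall>f\<in>Arr C x y. RepMap V x y f \<in> linear_maps R (RepMod V x) (RepMod V y)) \<and>
     (\<forall>x\<in>Obj C. \<forall>v\<in>carrier (RepMod V x). RepMap V x x (Ident C x) v = v) \<and>
     (\<forall>x\<in>Obj C. \<forall>y\<in>Obj C. \<forall>z\<in>Obj C. \<forall>f\<in>Arr C x y. \<forall>g\<in>Arr C y z. \<forall>v\<in>carrier (RepMod V x).
        RepMap V x z (Comp C x y z g f) v = RepMap V y z g (RepMap V x y f v))"

definition natural_transformations ::
  "('o, 'f) category \<Rightarrow> ('k, 'c) ring_scheme \<Rightarrow> ('o, 'f, 'k, 'm) rep \<Rightarrow> ('o, 'f, 'k, 'n) rep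
    \<Rightarrow> ('o \<Rightarrow> 'm \<Rightarrow> 'n) set" where
  "natural_transformations C R V W = {\<eta>.
     (\<forall>x\<in>Obj C. \<eta> x \<in> linear_maps R (RepMod V x) (RepMod W x)) \<and>
     (\<forall>x\<in>Obj C. \<forall>y\<in>Obj C. \<forall>f\<in>Arr C x y. \<forall>v\<in>carrier (RepMod V x).
        \<eta> y (RepMap V x y f v) = RepMap W x y f (\<eta> x v))}"

definition is_quotient_of ::
  "('o, 'f) category \<Rightarrow> ('k, 'c) ring_scheme \<Rightarrow> ('o, 'f, 'k, 'n) rep \<Rightarrow> ('o, 'f, 'k, 'm) rep \<Rightarrow> bool"
  where
  "is_quotient_of C R W V \<longleftrightarrow> (\<exists>\<eta>\<in>natural_transformations C R V W.
     \<forall>x\<in>Obj C. \<eta> x ` carrier (RepMod V x) = carrier (RepMod W x))"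

text \<open>On \<open>principal_projective C R x\<close> a morphism \<open>g : y \<rightarrow> z\<close> acts as the linear extension of \<open>f \<mapsto> g \<circ> f\<close>,
  so the coefficient of \<open>h\<close> in the image of \<open>\<phi>\<close> is the sum of \<open>\<phi> f\<close> over all \<open>f\<close> with \<open>g \<circ> f = h\<close>.\<close>

definition principal_projective ::
  "('o, 'f) category \<Rightarrow> ('k, 'c) ring_scheme \<Rightarrow> 'o \<Rightarrow> ('o, 'f, 'k, 'f \<Rightarrow> 'k) rep" where
  "principal_projective C R x = \<lparr>
     RepMod = (\<lambda>y. free_module R (Arr C x y)),
     RepMap = (\<lambda>y z g \<phi> h. \<Oplus>\<^bsub>R\<^esub>f\<in>{f. \<phi> f \<noteq> \<zero>\<^bsub>R\<^esub> \<and> Comp C x y z g f = h}. \<phi> f)\<rparr>"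

text \<open>The direct sum of a family of representations over a finite index set.\<close>

definition direct_sum :: "'i set \<Rightarrow> ('i \<Rightarrow> ('o, 'f, 'k, 'm) rep) \<Rightarrow> ('o, 'f, 'k, 'i \<Rightarrow> 'm) rep" where
  "direct_sum I V = \<lparr>
     RepMod = (\<lambda>x. \<lparr>
       carrier = (\<Pi>\<^sub>E i\<in>I. carrier (RepMod (V i) x)),
       monoid.mult = undefined,
       monoid.one = undefined,
       ring.zero = (\<lambda>i\<in>I. \<zero>\<^bsub>RepMod (V i) x\<^esub>),
       ring.add = (\<lambda>u v. \<lambda>i\<in>I. u i \<oplus>\<^bsub>RepMod (V i) x\<^esub> v i),
       module.smult = (\<lambda>a u. \<lambda>i\<in>I. a \<odot>\<^bsub>RepMod (V i) x\<^esub> u i)\<rparr>),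
     RepMap = (\<lambda>x y f u. \<lambda>i\<in>I. RepMap (V i) x y f (u i))\<rparr>"

definition finitely_generated_rep ::
  "('o, 'f) category \<Rightarrow> ('k, 'c) ring_scheme \<Rightarrow> ('o, 'f, 'k, 'm) rep \<Rightarrow> bool" where
  "finitely_generated_rep C R V \<longleftrightarrow> (\<exists>(n::nat) xs. (\<forall>i<n. xs i \<in> Obj C) \<and>
     is_quotient_of C R V (direct_sum {..<n} (\<lambda>i. principal_projective C R (xs i))))"

definition subrepresentation ::
  "('o, 'f) category \<Rightarrow> ('k, 'c) ring_scheme \<Rightarrow> ('o, 'f, 'k, 'm) rep \<Rightarrow> ('o \<Rightarrow> 'm set) \<Rightarrow> bool" where
  "subrepresentation C R V N \<longleftrightarrow>
     (\<forall>x\<in>Obj C. submodule (N x) R (RepMod V x)) \<and>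
     (\<forall>x\<in>Obj C. \<forall>y\<in>Obj C. \<forall>f\<in>Arr C x y. RepMap V x y f ` N x \<subseteq> N y)"

definition noetherian_rep ::
  "('o, 'f) category \<Rightarrow> ('k, 'c) ring_scheme \<Rightarrow> ('o, 'f, 'k, 'm) rep \<Rightarrow> bool" where
  "noetherian_rep C R V \<longleftrightarrow> (\<forall>N :: nat \<Rightarrow> 'o \<Rightarrow> 'm set.
     (\<forall>i. subrepresentation C R V (N i)) \<and> (\<forall>i. \<forall>x\<in>Obj C. N i x \<subseteq> N (Suc i) x)
     \<longrightarrow> (\<exists>n. \<forall>m\<ge>n. \<forall>x\<in>Obj C. N m x = N n x))"

text \<open>The type argument is the universe from which the elements of the modules are taken. A finitely
  generated representation is the image of a direct sum of principal projectives, whose elements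
  have type \<open>nat \<Rightarrow> 'f \<Rightarrow> 'k\<close>. Hence, as soon as that type injects into \<open>'m\<close>, every finitely generated
  representation, with modules on any type, is isomorphic to one whose modules live on \<open>'m\<close>.\<close>

definition noetherian_Rep ::
  "'m itself \<Rightarrow> ('o, 'f) category \<Rightarrow> ('k, 'c) ring_scheme \<Rightarrow> bool" where
  "noetherian_Rep (_ :: 'm itself) C R \<longleftrightarrow> (\<forall>V :: ('o, 'f, 'k, 'm) rep.
     representation C R V \<and> finitely_generated_rep C R V \<longrightarrow> noetherian_rep C R V)"


section \<open>Left noetherian rings and group algebras\<close>

definition left_ideal :: "'a set \<Rightarrow> ('a, 'c) ring_scheme \<Rightarrow> bool" where
  "left_ideal I R \<longleftrightarrow> additive_subgroup I R \<and> (\<forall>a\<in>carrier R. \<forall>u\<in>I. a \<otimes>\<^bsub>R\<^esub> u \<in> I)"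

definition left_noetherian :: "('a, 'c) ring_scheme \<Rightarrow> bool" where
  "left_noetherian R \<longleftrightarrow> (\<forall>I :: nat \<Rightarrow> 'a set.
     (\<forall>i. left_ideal (I i) R) \<and> (\<forall>i. I i \<subseteq> I (Suc i)) \<longrightarrow> (\<exists>n. \<forall>m\<ge>n. I m = I n))"

text \<open>The free left module on the elements of \<open>H\<close> with the convolution product.\<close>

definition group_algebra ::
  "('k, 'c) ring_scheme \<Rightarrow> ('h, 'b) monoid_scheme \<Rightarrow> ('k, 'h \<Rightarrow> 'k) module" where
  "group_algebra R H = (free_module R (carrier H))\<lparr>
     monoid.mult := (\<lambda>\<phi> \<psi> h. \<Oplus>\<^bsub>R\<^esub>s\<in>{(p, q). \<phi> p \<noteq> \<zero>\<^bsub>R\<^esub> \<and> \<psi> q \<noteq> \<zero>\<^bsub>R\<^esub> \<and> p \<otimes>\<^bsub>H\<^esub> q = h}.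
       \<phi> (fst s) \<otimes>\<^bsub>R\<^esub> \<psi> (snd s)),
     monoid.one := (\<lambda>h. if h = \<one>\<^bsub>H\<^esub> then \<one>\<^bsub>R\<^esub> else \<zero>\<^bsub>R\<^esub>)\<rparr>"

end

theory Submission
  imports Defs "HOL-Library.List_Lexorder"
begin

text \<open>
  Every finitely generated representation is a quotient of a finite direct sum of principal
  projectives, and noetherianity passes to quotients, so the left-hand side of the theorem says
  that all finite direct sums of the \<open>P\<^sub>A\<close> are noetherian (\<open>noetherian_Rep_iff_sums\<close>). Morphisms of
  \<open>FI\<^sub>G\<close> are monomorphisms, hence a morphism acts on \<open>P\<^sub>A\<close> by relabelling basis elements without
  ever merging two of them.

  A morphism \<open>(f, \<rho>) : A \<rightarrow> B\<close> is an injection \<open>f\<close> with a labelling \<open>\<rho> \<in> G\<^sup>A\<close>. So \<open>P\<^sub>A(B)\<close> splits into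
  blocks, one for each injection \<open>f\<close>, and each block is a copy of \<open>k[G\<^sup>A]\<close>, in fact of
  \<open>k[G\<^sup>n]\<close> with \<open>n\<close> the size of \<open>A\<close>. A morphism \<open>(g, \<sigma>)\<close> carries the block of \<open>f\<close> to the block of
  \<open>g \<circ> f\<close>, and does so by left translation with \<open>\<sigma> \<circ> f\<close> (\<open>block_of_map\<close>). Left ideals of \<open>k[G\<^sup>A]\<close>
  are the submodules closed under left translation (\<open>left_ideal_group_algebra_iff\<close>), and this is
  what links the two sides.

  If representations are noetherian: given a left ideal \<open>I\<close> of \<open>k[G\<^sup>A]\<close>, the elements of \<open>P\<^sub>A\<close> with all
  blocks in \<open>I\<close> form a subrepresentation, from which \<open>I\<close> is recovered as the set of blocks at the
  identity of \<open>A\<close>. Ascending chains of left ideals therefore stabilize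
  (\<open>left_noetherian_of_principal_projective\<close>).

  If the group algebras are noetherian, a Groebner argument applies. Only the sets \<open>{0, \<dots>, n - 1}\<close>
  matter, and an injection into such a set is a list of its values; together with the index of the
  summand this is a monomial, and monomials are ordered lexicographically. Strictly increasing
  maps preserve this order, and permit to compare leading coefficients at different \<open>n\<close>. The
  coefficients of a subrepresentation at a given leading monomial form a left ideal, because the
  automorphisms of \<open>{0, \<dots>, n - 1}\<close> that only change labels realize all left translations
  (\<open>left_ideal_leading\<close>), and this ideal grows along increasing maps (\<open>leading_shift\<close>).
  By Dickson's lemma every sequence of monomials has a subsequence in which each term is carried to
  every later one by an increasing map (\<open>monomials_wqo\<close>). A chain of subrepresentations that jumps
  infinitely often would yield along such a subsequence a strictly ascending chain of left ideals in
  one \<open>k[G\<^sup>A]\<close>; and a chain whose leading coefficients no longer jump is constant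
  (\<open>leading_coefficients_determine_submodule\<close>).
\<close>

section \<open>Left modules\<close>

context left_module
begin

lemma smult_zero_left: "v \<in> carrier M \<Longrightarrow> \<zero> \<odot>\<^bsub>M\<^esub> v = \<zero>\<^bsub>M\<^esub>"
  using smult_l_distr[of \<zero> \<zero> v] smult_closed[of \<zero> v] M.add.r_cancel_one' by force

lemma smult_neg_one: "v \<in> carrier M \<Longrightarrow> (\<ominus> \<one>) \<odot>\<^bsub>M\<^esub> v = \<ominus>\<^bsub>M\<^esub> v"
  using smult_l_distr[of "\<ominus> \<one>" \<one> v] smult_closed[of "\<ominus> \<one>" v] smult_one[of v]
  by (metis R.add.inv_closed R.l_neg R.one_closed M.minus_equality smult_zero_left)

text \<open>Closure under negation comes for free, as negation is multiplication by \<open>- 1\<close>.\<close>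

lemma submodule_intro:
  assumes "N \<subseteq> carrier M" and "\<zero>\<^bsub>M\<^esub> \<in> N"
    and "\<And>u v. u \<in> N \<Longrightarrow> v \<in> N \<Longrightarrow> u \<oplus>\<^bsub>M\<^esub> v \<in> N"
    and smult: "\<And>a v. a \<in> carrier R \<Longrightarrow> v \<in> N \<Longrightarrow> a \<odot>\<^bsub>M\<^esub> v \<in> N"
  shows "submodule N R M"
proof -
  have "\<ominus>\<^bsub>M\<^esub> v \<in> N" if "v \<in> N" for v
    using that smult[of "\<ominus> \<one>" v] smult_neg_one[of v] assms(1) by auto
  then show ?thesis
    using assms by (intro submodule.intro subgroup.intro) (simp_all add: submodule_axioms_def a_inv_def)
qed

lemma submodule_minus:
  assumes "submodule N R M" and "u \<in> N" and "v \<in> N"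
  shows "u \<ominus>\<^bsub>M\<^esub> v \<in> N"
  using assms subgroup.m_inv_closed[of N "add_monoid M" v] subgroup.m_closed[of N "add_monoid M"]
  by (simp add: submodule_def a_minus_def a_inv_def)

end

lemma submoduleD:
  assumes "submodule N R M"
  shows "N \<subseteq> carrier M" and "\<zero>\<^bsub>M\<^esub> \<in> N"
    and "u \<in> N \<Longrightarrow> v \<in> N \<Longrightarrow> u \<oplus>\<^bsub>M\<^esub> v \<in> N"
    and "a \<in> carrier R \<Longrightarrow> v \<in> N \<Longrightarrow> a \<odot>\<^bsub>M\<^esub> v \<in> N"
  using assms subgroup.subset[of N "add_monoid M"] subgroup.one_closed[of N "add_monoid M"]
    subgroup.m_closed[of N "add_monoid M"]
  by (auto simp: submodule_def submodule_axioms_def)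

lemma linear_mapsD:
  assumes "t \<in> linear_maps R M N"
  shows "v \<in> carrier M \<Longrightarrow> t v \<in> carrier N"
    and "u \<in> carrier M \<Longrightarrow> v \<in> carrier M \<Longrightarrow> t (u \<oplus>\<^bsub>M\<^esub> v) = t u \<oplus>\<^bsub>N\<^esub> t v"
    and "a \<in> carrier R \<Longrightarrow> v \<in> carrier M \<Longrightarrow> t (a \<odot>\<^bsub>M\<^esub> v) = a \<odot>\<^bsub>N\<^esub> t v"
  using assms by (auto simp: linear_maps_def)

lemma linear_map_zero:
  assumes "left_module R M" and "left_module R N" and "t \<in> linear_maps R M N"
  shows "t \<zero>\<^bsub>M\<^esub> = \<zero>\<^bsub>N\<^esub>"
proof -
  interpret M: left_module R M by fact
  interpret N: left_module R N by fact
  have "t \<zero>\<^bsub>M\<^esub> = \<zero>\<^bsub>R\<^esub> \<odot>\<^bsub>N\<^esub> t \<zero>\<^bsub>M\<^esub>"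
    using linear_mapsD(3)[OF assms(3) M.R.zero_closed M.M.zero_closed]
      M.smult_zero_left[OF M.M.zero_closed] by simp
  then show ?thesis
    using N.smult_zero_left[OF linear_mapsD(1)[OF assms(3) M.M.zero_closed]] by simp
qed

lemma submodule_vimage:
  assumes "left_module R M" and "left_module R N" and "t \<in> linear_maps R M N"
    and "submodule L R N"
  shows "submodule {v \<in> carrier M. t v \<in> L} R M"
proof -
  interpret M: left_module R M by fact
  show ?thesis
    using linear_mapsD[OF assms(3)] submoduleD[OF assms(4)] linear_map_zero[OF assms(1,2,3)]
    by (intro M.submodule_intro) (auto simp: M.smult_closed)
qed

lemma free_moduleD:
  assumes "\<phi> \<in> carrier (free_module R S)"
  shows "\<phi> s \<in> carrier R" and "s \<notin> S \<Longrightarrow> \<phi> s = \<zero>\<^bsub>R\<^esub>"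
    and "finite {s. \<phi> s \<noteq> \<zero>\<^bsub>R\<^esub>}"
  using assms by (auto simp: free_module_def)

lemma left_module_free_module:
  fixes R (structure)
  assumes "ring R"
  shows "left_module R (free_module R S)"
proof -
  interpret ring R by fact
  have neg: "\<exists>\<psi>\<in>carrier (free_module R S). \<psi> \<oplus>\<^bsub>free_module R S\<^esub> \<phi> = \<zero>\<^bsub>free_module R S\<^esub>"
    if "\<phi> \<in> carrier (free_module R S)" for \<phi>
  proof
    have "{s. \<ominus> \<phi> s \<noteq> \<zero>} \<subseteq> {s. \<phi> s \<noteq> \<zero>}" by auto
    with that show "(\<lambda>s. \<ominus> \<phi> s) \<in> carrier (free_module R S)"
      by (auto simp: free_module_def Pi_def intro: finite_subset)
    show "(\<lambda>s. \<ominus> \<phi> s) \<oplus>\<^bsub>free_module R S\<^esub> \<phi> = \<zero>\<^bsub>free_module R S\<^esub>"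
      using that by (auto simp: free_module_def Pi_def l_neg)
  qed
  have closed: "\<phi> \<oplus>\<^bsub>free_module R S\<^esub> \<psi> \<in> carrier (free_module R S)"
    if "\<phi> \<in> carrier (free_module R S)" "\<psi> \<in> carrier (free_module R S)" for \<phi> \<psi>
  proof -
    have "{s. \<phi> s \<oplus> \<psi> s \<noteq> \<zero>} \<subseteq> {s. \<phi> s \<noteq> \<zero>} \<union> {s. \<psi> s \<noteq> \<zero>}" by auto
    with that show ?thesis
      by (auto simp: free_module_def Pi_def intro: finite_subset)
  qed
  have smult: "a \<odot>\<^bsub>free_module R S\<^esub> \<phi> \<in> carrier (free_module R S)"
    if "a \<in> carrier R" "\<phi> \<in> carrier (free_module R S)" for a \<phi>
  proof -
    have "{s. a \<otimes> \<phi> s \<noteq> \<zero>} \<subseteq> {s. \<phi> s \<noteq> \<zero>}" using that by auto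
    with that show ?thesis
      by (auto simp: free_module_def Pi_def intro: finite_subset)
  qed
  interpret M: abelian_group "free_module R S"
    by (intro abelian_groupI neg closed)
      (auto simp: free_module_def Pi_def a_assoc intro!: ext intro: a_comm)
  show ?thesis
    using smult by unfold_locales
      (auto simp: free_module_def Pi_def fun_eq_iff l_distr r_distr m_assoc)
qed

section \<open>Representations\<close>

lemma representationD:
  assumes "representation C R V"
  shows "x \<in> Obj C \<Longrightarrow> left_module R (RepMod V x)"
    and "x \<in> Obj C \<Longrightarrow> y \<in> Obj C \<Longrightarrow> f \<in> Arr C x y
      \<Longrightarrow> RepMap V x y f \<in> linear_maps R (RepMod V x) (RepMod V y)"
    and "x \<in> Obj C \<Longrightarrow> v \<in> carrier (RepMod V x) \<Longrightarrow> RepMap V x x (Ident C x) v = v"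
    and "x \<in> Obj C \<Longrightarrow> y \<in> Obj C \<Longrightarrow> z \<in> Obj C \<Longrightarrow> f \<in> Arr C x y \<Longrightarrow> g \<in> Arr C y z
      \<Longrightarrow> v \<in> carrier (RepMod V x)
      \<Longrightarrow> RepMap V x z (Comp C x y z g f) v = RepMap V y z g (RepMap V x y f v)"
  using assms unfolding representation_def by blast+

lemma natural_transformationsD:
  assumes "\<eta> \<in> natural_transformations C R V W"
  shows "x \<in> Obj C \<Longrightarrow> \<eta> x \<in> linear_maps R (RepMod V x) (RepMod W x)"
    and "x \<in> Obj C \<Longrightarrow> y \<in> Obj C \<Longrightarrow> f \<in> Arr C x y \<Longrightarrow> v \<in> carrier (RepMod V x)
      \<Longrightarrow> \<eta> y (RepMap V x y f v) = RepMap W x y f (\<eta> x v)"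
  using assms unfolding natural_transformations_def by blast+

lemma subrepresentationD:
  assumes "subrepresentation C R V N" and "x \<in> Obj C"
  shows "submodule (N x) R (RepMod V x)" and "v \<in> N x \<Longrightarrow> v \<in> carrier (RepMod V x)"
    and "y \<in> Obj C \<Longrightarrow> f \<in> Arr C x y \<Longrightarrow> v \<in> N x \<Longrightarrow> RepMap V x y f v \<in> N y"
proof -
  show sub: "submodule (N x) R (RepMod V x)"
    using assms by (simp add: subrepresentation_def)
  show "v \<in> N x \<Longrightarrow> v \<in> carrier (RepMod V x)"
    using submoduleD(1)[OF sub] by blast
  show "y \<in> Obj C \<Longrightarrow> f \<in> Arr C x y \<Longrightarrow> v \<in> N x \<Longrightarrow> RepMap V x y f v \<in> N y"
    using assms unfolding subrepresentation_def by blast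
qed

lemma subrepresentation_vimage:
  assumes V: "representation C R V" and W: "representation C R W"
    and \<eta>: "\<eta> \<in> natural_transformations C R V W" and N: "subrepresentation C R W N"
  shows "subrepresentation C R V (\<lambda>x. {v \<in> carrier (RepMod V x). \<eta> x v \<in> N x})"
  unfolding subrepresentation_def
proof (intro conjI ballI)
  fix x assume "x \<in> Obj C"
  then show "submodule {v \<in> carrier (RepMod V x). \<eta> x v \<in> N x} R (RepMod V x)"
    using N submodule_vimage[OF representationD(1)[OF V] representationD(1)[OF W]
        natural_transformationsD(1)[OF \<eta>]]
    by (auto simp: subrepresentation_def)
next
  fix x y f assume "x \<in> Obj C" "y \<in> Obj C" "f \<in> Arr C x y"
  then show "RepMap V x y f ` {v \<in> carrier (RepMod V x). \<eta> x v \<in> N x}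
      \<subseteq> {v \<in> carrier (RepMod V y). \<eta> y v \<in> N y}"
    using N natural_transformationsD(2)[OF \<eta>] linear_mapsD(1)[OF representationD(2)[OF V]]
    by (auto simp: subrepresentation_def image_subset_iff)
qed

text \<open>A chain in a quotient is recovered from its preimage chain, because taking the preimage under
  a surjection is injective on subsets.\<close>

lemma noetherian_rep_quotient:
  assumes V: "representation C R V" and W: "representation C R W"
    and quot: "is_quotient_of C R W V" and noeth: "noetherian_rep C R V"
  shows "noetherian_rep C R W"
  unfolding noetherian_rep_def
proof (intro allI impI)
  fix N
  assume N: "(\<forall>i. subrepresentation C R W (N i)) \<and> (\<forall>i. \<forall>x\<in>Obj C. N i x \<subseteq> N (Suc i) x)"
  obtain \<eta> where \<eta>: "\<eta> \<in> natural_transformations C R V W"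
    and surj: "\<And>x. x \<in> Obj C \<Longrightarrow> \<eta> x ` carrier (RepMod V x) = carrier (RepMod W x)"
    using quot unfolding is_quotient_of_def by blast
  define N' where "N' = (\<lambda>i x. {v \<in> carrier (RepMod V x). \<eta> x v \<in> N i x})"
  have "\<forall>i. subrepresentation C R V (N' i)"
    using subrepresentation_vimage[OF V W \<eta>] N by (auto simp: N'_def)
  moreover have "\<forall>i. \<forall>x\<in>Obj C. N' i x \<subseteq> N' (Suc i) x"
    using N by (auto simp: N'_def)
  ultimately obtain n where n: "\<forall>m\<ge>n. \<forall>x\<in>Obj C. N' m x = N' n x"
    using noeth unfolding noetherian_rep_def by blast
  have image: "\<eta> x ` N' i x = N i x" if "x \<in> Obj C" for i x
  proof -
    have "N i x \<subseteq> carrier (RepMod W x)"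
      using N that submoduleD(1) by (fastforce simp: subrepresentation_def)
    then show ?thesis
      unfolding N'_def surj[OF that, symmetric] by auto
  qed
  show "\<exists>n. \<forall>m\<ge>n. \<forall>x\<in>Obj C. N m x = N n x"
    using n image by metis
qed

text \<open>A subrepresentation at \<open>x\<close> is determined by its value at any object through which the identity
  of \<open>x\<close> factors. This reduces questions about all finite sets to one set of each size.\<close>

lemma subrepresentation_eq_at_iso:
  assumes V: "representation C R V" and N: "subrepresentation C R V N"
    and N': "subrepresentation C R V N'"
    and obj: "x \<in> Obj C" "y \<in> Obj C" and f: "f \<in> Arr C x y" and g: "g \<in> Arr C y x"
    and inv: "Comp C x y x g f = Ident C x" and eq: "N y = N' y"
  shows "N x = N' x"
proof -
  have "L' x \<subseteq> L x" if L: "subrepresentation C R V L" and L': "subrepresentation C R V L'"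
    and "L y = L' y" for L L'
  proof
    fix v assume v: "v \<in> L' x"
    then have "RepMap V x y f v \<in> L y"
      using subrepresentationD(3)[OF L' obj(1,2) f v] \<open>L y = L' y\<close> by simp
    then have "RepMap V y x g (RepMap V x y f v) \<in> L x"
      by (rule subrepresentationD(3)[OF L obj(2,1) g])
    moreover have "v \<in> carrier (RepMod V x)"
      by (rule subrepresentationD(2)[OF L' obj(1) v])
    ultimately show "v \<in> L x"
      using representationD(4)[OF V obj(1,2,1) f g] representationD(3)[OF V obj(1)] inv by simp
  qed
  from this[OF N N' eq] this[OF N' N eq[symmetric]] show ?thesis by blast
qed

lemma left_module_direct_sum:
  assumes "ring R" and "\<And>i. i \<in> I \<Longrightarrow> left_module R (RepMod (V i) x)"
  shows "left_module R (RepMod (direct_sum I V) x)"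
proof -
  interpret ring R by fact
  let ?D = "RepMod (direct_sum I V) x"
  have ag: "abelian_group (RepMod (V i) x)" if "i \<in> I" for i
    using assms(2)[OF that] by (simp add: left_module_def)
  note am = abelian_group.axioms(1)[OF ag]
  interpret M: abelian_group ?D
  proof (rule abelian_groupI)
    fix u assume u: "u \<in> carrier ?D"
    have "(\<lambda>i\<in>I. \<ominus>\<^bsub>RepMod (V i) x\<^esub> u i) \<in> carrier ?D"
      using u by (auto simp: direct_sum_def intro!: abelian_group.a_inv_closed ag)
    moreover have "(\<lambda>i\<in>I. \<ominus>\<^bsub>RepMod (V i) x\<^esub> u i) \<oplus>\<^bsub>?D\<^esub> u = \<zero>\<^bsub>?D\<^esub>"
      using u by (auto simp: direct_sum_def fun_eq_iff PiE_def Pi_def abelian_group.l_neg[OF ag])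
    ultimately show "\<exists>v\<in>carrier ?D. v \<oplus>\<^bsub>?D\<^esub> u = \<zero>\<^bsub>?D\<^esub>" by blast
  qed (auto simp: direct_sum_def fun_eq_iff PiE_def Pi_def extensional_def
      intro: abelian_monoid.a_closed[OF am] abelian_monoid.zero_closed[OF am]
        abelian_monoid.a_assoc[OF am] abelian_monoid.a_comm[OF am] abelian_monoid.l_zero[OF am])
  show ?thesis
    by unfold_locales
      (auto simp: direct_sum_def fun_eq_iff PiE_def Pi_def extensional_def
        intro: left_module.smult_closed[OF assms(2)] left_module.smult_l_distr[OF assms(2)]
          left_module.smult_r_distr[OF assms(2)] left_module.smult_assoc1[OF assms(2)]
          left_module.smult_one[OF assms(2)])
qed

lemma representation_direct_sum:
  assumes "ring R" and "category C" and V: "\<And>i. i \<in> I \<Longrightarrow> representation C R (V i)"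
  shows "representation C R (direct_sum I V)"
  unfolding representation_def
proof (intro conjI ballI)
  interpret category C by fact
  show "left_module R (RepMod (direct_sum I V) x)" if "x \<in> Obj C" for x
    using that representationD(1)[OF V] by (intro left_module_direct_sum assms) blast
  show "RepMap (direct_sum I V) x y f
      \<in> linear_maps R (RepMod (direct_sum I V) x) (RepMod (direct_sum I V) y)"
    if "x \<in> Obj C" "y \<in> Obj C" "f \<in> Arr C x y" for x y f
    using linear_mapsD[OF representationD(2)[OF V that]]
      left_module.smult_closed[OF representationD(1)[OF V that(1)]]
    by (auto simp: linear_maps_def direct_sum_def PiE_def Pi_def fun_eq_iff)
  show "RepMap (direct_sum I V) x x (Ident C x) v = v"
    if "x \<in> Obj C" "v \<in> carrier (RepMod (direct_sum I V) x)" for x v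
    using that representationD(3)[OF V that(1)]
    by (auto simp: direct_sum_def PiE_def Pi_def fun_eq_iff extensional_def)
  show "RepMap (direct_sum I V) x z (Comp C x y z g f) v
      = RepMap (direct_sum I V) y z g (RepMap (direct_sum I V) x y f v)"
    if "x \<in> Obj C" "y \<in> Obj C" "z \<in> Obj C" "f \<in> Arr C x y" "g \<in> Arr C y z"
      "v \<in> carrier (RepMod (direct_sum I V) x)" for x y z f g v
    using that representationD(4)[OF V that(1-5)]
    by (auto simp: direct_sum_def PiE_def Pi_def fun_eq_iff)
qed

text \<open>A copy of a representation whose modules live on another type, so that the finite sums of
  principal projectives become objects of the category of representations over any universe
  that is large enough.\<close>

definition transported_rep :: "('n \<Rightarrow> 'm) \<Rightarrow> ('o, 'f, 'k, 'n) rep \<Rightarrow> ('o, 'f, 'k, 'm) rep" where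
  "transported_rep e V = \<lparr>
     RepMod = (\<lambda>x. \<lparr>
       carrier = e ` carrier (RepMod V x),
       monoid.mult = undefined,
       monoid.one = undefined,
       ring.zero = e \<zero>\<^bsub>RepMod V x\<^esub>,
       ring.add = (\<lambda>u v. e (inv_into UNIV e u \<oplus>\<^bsub>RepMod V x\<^esub> inv_into UNIV e v)),
       module.smult = (\<lambda>a u. e (a \<odot>\<^bsub>RepMod V x\<^esub> inv_into UNIV e u))\<rparr>),
     RepMap = (\<lambda>x y f u. e (RepMap V x y f (inv_into UNIV e u)))\<rparr>"

lemma representation_transported:
  assumes "inj e" and V: "representation C R V" and "category C"
  shows "representation C R (transported_rep e V)"
  unfolding representation_def
proof (intro conjI ballI)
  interpret category C by fact
  note e [simp] = inv_f_f[OF \<open>inj e\<close>]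
  fix x assume x: "x \<in> Obj C"
  interpret M: left_module R "RepMod V x"
    by (rule representationD(1)[OF V x])
  let ?T = "RepMod (transported_rep e V) x"
  interpret T: abelian_group ?T
  proof (rule abelian_groupI)
    fix u assume "u \<in> carrier ?T"
    then obtain v where v: "u = e v" "v \<in> carrier (RepMod V x)"
      by (auto simp: transported_rep_def)
    have "e (\<ominus>\<^bsub>RepMod V x\<^esub> v) \<in> carrier ?T" "e (\<ominus>\<^bsub>RepMod V x\<^esub> v) \<oplus>\<^bsub>?T\<^esub> u = \<zero>\<^bsub>?T\<^esub>"
      using v by (auto simp: transported_rep_def M.M.l_neg)
    then show "\<exists>w\<in>carrier ?T. w \<oplus>\<^bsub>?T\<^esub> u = \<zero>\<^bsub>?T\<^esub>" by blast
  qed (auto simp: transported_rep_def M.M.a_assoc intro!: arg_cong[where f = e] M.M.a_comm)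
  show "left_module R ?T"
    by unfold_locales
      (auto simp: transported_rep_def M.smult_closed M.smult_l_distr M.smult_r_distr M.smult_assoc1
        M.smult_one)
  show "RepMap (transported_rep e V) x x (Ident C x) v = v" if "v \<in> carrier ?T" for v
    using that representationD(3)[OF V x] by (auto simp: transported_rep_def)
  fix y f assume y: "y \<in> Obj C" and f: "f \<in> Arr C x y"
  show "RepMap (transported_rep e V) x y f
      \<in> linear_maps R ?T (RepMod (transported_rep e V) y)"
    using linear_mapsD[OF representationD(2)[OF V x y f]]
    by (auto simp: linear_maps_def transported_rep_def)
  fix z g v assume "z \<in> Obj C" "g \<in> Arr C y z" "v \<in> carrier ?T"
  then show "RepMap (transported_rep e V) x z (Comp C x y z g f) v
      = RepMap (transported_rep e V) y z g (RepMap (transported_rep e V) x y f v)"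
    using representationD(4)[OF V x y _ f] by (auto simp: transported_rep_def)
qed

lemma quotient_transported:
  assumes "inj e"
  shows "is_quotient_of C R (transported_rep e V) V"
  unfolding is_quotient_of_def
  using assms
  by (intro bexI[where x = "\<lambda>_. e"])
    (auto simp: natural_transformations_def linear_maps_def transported_rep_def)

lemma quotient_of_transported:
  assumes "inj e"
  shows "is_quotient_of C R V (transported_rep e V)"
  unfolding is_quotient_of_def
  using assms
  by (intro bexI[where x = "\<lambda>_. inv_into UNIV e"])
    (auto simp: natural_transformations_def linear_maps_def transported_rep_def image_image)

lemma finitely_generated_representation_noetherian:
  fixes V :: "('o, 'f, 'k, 'm) rep"
  assumes "ring R" and "category C"
    and P: "\<And>x. x \<in> Obj C \<Longrightarrow> representation C R (principal_projective C R x)"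
    and noeth: "\<And>(n::nat) xs. (\<forall>i<n. xs i \<in> Obj C)
      \<Longrightarrow> noetherian_rep C R (direct_sum {..<n} (\<lambda>i. principal_projective C R (xs i)))"
    and "representation C R V" and "finitely_generated_rep C R V"
  shows "noetherian_rep C R V"
proof -
  obtain n :: nat and xs where xs: "\<forall>i<n. xs i \<in> Obj C"
    and quot: "is_quotient_of C R V (direct_sum {..<n} (\<lambda>i. principal_projective C R (xs i)))"
    using assms(6) unfolding finitely_generated_rep_def by blast
  show ?thesis
    using xs by (intro noetherian_rep_quotient[OF _ assms(5) quot noeth]
        representation_direct_sum assms P) auto
qed

text \<open>The finite direct sums of principal projectives generate everything, and are themselves
  finitely generated once they are moved into the universe \<open>'m\<close>.\<close>

lemma noetherian_Rep_iff_sums: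
  fixes e :: "(nat \<Rightarrow> 'f \<Rightarrow> 'k) \<Rightarrow> 'm"
    and C :: "('o, 'f) category" and R :: "('k, 'c) ring_scheme"
  assumes "ring R" and "category C" and "inj e"
    and P: "\<And>x. x \<in> Obj C \<Longrightarrow> representation C R (principal_projective C R x)"
  shows "noetherian_Rep TYPE('m) C R \<longleftrightarrow> (\<forall>(n::nat) xs. (\<forall>i<n. xs i \<in> Obj C) \<longrightarrow>
    noetherian_rep C R (direct_sum {..<n} (\<lambda>i. principal_projective C R (xs i))))"
    (is "?L \<longleftrightarrow> ?R")
proof
  assume ?L
  show ?R
  proof (intro allI impI)
    fix n :: nat and xs assume xs: "\<forall>i<n. xs i \<in> Obj C"
    let ?D = "direct_sum {..<n} (\<lambda>i. principal_projective C R (xs i))"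
    have D: "representation C R ?D"
      using xs by (intro representation_direct_sum assms) auto
    have T: "representation C R (transported_rep e ?D)"
      by (rule representation_transported[OF \<open>inj e\<close> D \<open>category C\<close>])
    have "finitely_generated_rep C R (transported_rep e ?D)"
      unfolding finitely_generated_rep_def using xs quotient_transported[OF \<open>inj e\<close>] by blast
    with \<open>?L\<close> T have "noetherian_rep C R (transported_rep e ?D)"
      unfolding noetherian_Rep_def by blast
    then show "noetherian_rep C R ?D"
      by (rule noetherian_rep_quotient[OF T D quotient_of_transported[OF \<open>inj e\<close>]])
  qed
next
  assume ?R
  then show ?L
    unfolding noetherian_Rep_def
    using finitely_generated_representation_noetherian[OF assms(1,2) P] by blast
qed

section \<open>Principal projectives of a category of monomorphisms\<close>

text \<open>Postcomposition with a monomorphism is injective on morphisms, so the sum that defines the action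
  on a principal projective has at most one term. The action is then described by its two values,
  on and off the image of postcomposition, and functoriality needs no rearrangement of sums.\<close>

locale monic_category = category C for C :: "('o, 'f) category" +
  assumes monic: "\<lbrakk>x \<in> Obj C; y \<in> Obj C; z \<in> Obj C; g \<in> Arr C y z\<rbrakk>
    \<Longrightarrow> inj_on (Comp C x y z g) (Arr C x y)"

context monic_category
begin

context
  fixes R :: "('k, 'c) ring_scheme" and x y z g \<phi>
  assumes R: "ring R" and obj: "x \<in> Obj C" "y \<in> Obj C" "z \<in> Obj C"
    and g: "g \<in> Arr C y z" and \<phi>: "\<phi> \<in> carrier (free_module R (Arr C x y))"
begin

lemma principal_projective_map_Comp:
  assumes f: "f \<in> Arr C x y"
  shows "RepMap (principal_projective C R x) y z g \<phi> (Comp C x y z g f) = \<phi> f"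
proof -
  interpret ring R by fact
  have "{f'. \<phi> f' \<noteq> \<zero>\<^bsub>R\<^esub> \<and> Comp C x y z g f' = Comp C x y z g f}
      = (if \<phi> f = \<zero>\<^bsub>R\<^esub> then {} else {f})"
    using \<phi> f inj_onD[OF monic[OF obj g] _ _ f] by (auto simp: free_module_def)
  then show ?thesis
    using \<phi> by (simp add: principal_projective_def free_module_def Pi_def)
qed

lemma principal_projective_map_off_image:
  assumes "h \<notin> Comp C x y z g ` Arr C x y"
  shows "RepMap (principal_projective C R x) y z g \<phi> h = \<zero>\<^bsub>R\<^esub>"
proof -
  interpret ring R by fact
  have "{f. \<phi> f \<noteq> \<zero>\<^bsub>R\<^esub> \<and> Comp C x y z g f = h} = {}"
    using \<phi> assms by (auto simp: free_module_def)
  then show ?thesis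
    by (simp add: principal_projective_def del: Collect_empty_eq)
qed

lemma principal_projective_map_closed:
  "RepMap (principal_projective C R x) y z g \<phi> \<in> carrier (free_module R (Arr C x z))"
proof -
  interpret ring R by fact
  let ?\<psi> = "RepMap (principal_projective C R x) y z g \<phi>"
  have closed: "?\<psi> h \<in> carrier R" for h
    using \<phi> principal_projective_map_Comp principal_projective_map_off_image
    by (cases "h \<in> Comp C x y z g ` Arr C x y") (auto simp: free_module_def)
  have supp: "{h. ?\<psi> h \<noteq> \<zero>\<^bsub>R\<^esub>} \<subseteq> Comp C x y z g ` {f \<in> Arr C x y. \<phi> f \<noteq> \<zero>\<^bsub>R\<^esub>}"
    using principal_projective_map_Comp principal_projective_map_off_image by force
  moreover have "finite {f \<in> Arr C x y. \<phi> f \<noteq> \<zero>\<^bsub>R\<^esub>}"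
    using \<phi> by (auto simp: free_module_def)
  ultimately have "finite {h. ?\<psi> h \<noteq> \<zero>\<^bsub>R\<^esub>}"
    by (blast intro: finite_subset)
  moreover have "Comp C x y z g ` {f \<in> Arr C x y. \<phi> f \<noteq> \<zero>\<^bsub>R\<^esub>} \<subseteq> Arr C x z"
    using Comp_closed[OF obj _ g] by blast
  ultimately show ?thesis
    using closed supp by (simp add: free_module_def subset_trans)
qed

end

lemma principal_projective_map_eqI:
  assumes "ring R" and "x \<in> Obj C" "y \<in> Obj C" "z \<in> Obj C" "g \<in> Arr C y z"
    and "\<phi> \<in> carrier (free_module R (Arr C x y))"
    and "\<And>f. f \<in> Arr C x y \<Longrightarrow> \<psi> (Comp C x y z g f) = \<phi> f"
    and "\<And>h. h \<notin> Comp C x y z g ` Arr C x y \<Longrightarrow> \<psi> h = \<zero>\<^bsub>R\<^esub>"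
  shows "RepMap (principal_projective C R x) y z g \<phi> = \<psi>"
proof
  fix h
  show "RepMap (principal_projective C R x) y z g \<phi> h = \<psi> h"
    using assms principal_projective_map_Comp[OF assms(1-6)]
      principal_projective_map_off_image[OF assms(1-6)]
    by (cases "h \<in> Comp C x y z g ` Arr C x y") auto
qed

lemma representation_principal_projective:
  assumes R: "ring R" and x: "x \<in> Obj C"
  shows "representation C R (principal_projective C R x)"
  unfolding representation_def
proof (intro conjI ballI)
  interpret R: ring R by fact
  let ?P = "principal_projective C R x"
  have Mod [simp]: "RepMod ?P y = free_module R (Arr C x y)" for y
    by (simp add: principal_projective_def)
  fix y assume y: "y \<in> Obj C"
  show "left_module R (RepMod ?P y)"
    by (simp add: left_module_free_module R)
  interpret M: left_module R "free_module R (Arr C x y)"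
    by (rule left_module_free_module[OF R])
  show "RepMap ?P y y (Ident C y) v = v" if "v \<in> carrier (RepMod ?P y)" for v
    using that y Comp_Ident_left[OF x y] Ident_closed[OF y]
    by (intro principal_projective_map_eqI R x) (auto simp: free_module_def image_def)
  fix z g assume z: "z \<in> Obj C" and g: "g \<in> Arr C y z"
  note map = principal_projective_map_Comp[OF R x y z g]
    principal_projective_map_off_image[OF R x y z g]
    principal_projective_map_closed[OF R x y z g]
  show "RepMap ?P y z g \<in> linear_maps R (RepMod ?P y) (RepMod ?P z)"
    unfolding linear_maps_def
  proof (intro CollectI conjI ballI)
    show "RepMap ?P y z g \<in> carrier (RepMod ?P y) \<rightarrow> carrier (RepMod ?P z)"
      using map(3) by auto
  next
    fix u v assume uv: "u \<in> carrier (RepMod ?P y)" "v \<in> carrier (RepMod ?P y)"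
    then show "RepMap ?P y z g (u \<oplus>\<^bsub>RepMod ?P y\<^esub> v)
        = RepMap ?P y z g u \<oplus>\<^bsub>RepMod ?P z\<^esub> RepMap ?P y z g v"
      using M.M.a_closed[of u v] map(1,2)[of u] map(1,2)[of v]
      by (intro principal_projective_map_eqI R x y z g) (auto simp: free_module_def)
  next
    fix a u assume au: "a \<in> carrier R" "u \<in> carrier (RepMod ?P y)"
    then show "RepMap ?P y z g (a \<odot>\<^bsub>RepMod ?P y\<^esub> u) = a \<odot>\<^bsub>RepMod ?P z\<^esub> RepMap ?P y z g u"
      using M.smult_closed[of a u] map(1,2)[of u]
      by (intro principal_projective_map_eqI R x y z g) (auto simp: free_module_def)
  qed
  fix w h v assume w: "w \<in> Obj C" and h: "h \<in> Arr C z w" and v: "v \<in> carrier (RepMod ?P y)"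
  then have v': "v \<in> carrier (free_module R (Arr C x y))" by simp
  note gv = map(3)[OF v']
  note hmap = principal_projective_map_Comp[OF R x z w h gv]
    principal_projective_map_off_image[OF R x z w h gv]
  show "RepMap ?P y w (Comp C y z w h g) v = RepMap ?P z w h (RepMap ?P y z g v)"
  proof (rule principal_projective_map_eqI[OF R x y w Comp_closed[OF y z w g h] v'])
    fix f assume f: "f \<in> Arr C x y"
    then show "RepMap ?P z w h (RepMap ?P y z g v) (Comp C x y w (Comp C y z w h g) f) = v f"
      using Comp_assoc[OF x y z w f g h] hmap(1)[OF Comp_closed[OF x y z f g]] map(1)[OF v' f]
      by simp
  next
    fix k assume k: "k \<notin> Comp C x y w (Comp C y z w h g) ` Arr C x y"
    show "RepMap ?P z w h (RepMap ?P y z g v) k = \<zero>\<^bsub>R\<^esub>"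
    proof (cases "k \<in> Comp C x z w h ` Arr C x z")
      case True
      then obtain f where f: "k = Comp C x z w h f" "f \<in> Arr C x z" by blast
      then have "f \<notin> Comp C x y z g ` Arr C x y"
        using k Comp_assoc[OF x y z w _ g h] by (auto simp: image_iff)
      then show ?thesis
        using hmap(1)[OF f(2)] map(2)[OF v'] f(1) by simp
    qed (rule hmap(2))
  qed
qed

end

section \<open>Left ideals of group algebras\<close>

text \<open>The product of the basis element \<open>p\<close> with \<open>\<phi>\<close> in the group algebra.\<close>

definition left_translate ::
  "('k, 'c) ring_scheme \<Rightarrow> ('h, 'b) monoid_scheme \<Rightarrow> 'h \<Rightarrow> ('h \<Rightarrow> 'k) \<Rightarrow> 'h \<Rightarrow> 'k" where
  "left_translate R H p \<phi> =
    (\<lambda>h. if h \<in> carrier H then \<phi> (inv\<^bsub>H\<^esub> p \<otimes>\<^bsub>H\<^esub> h) else \<zero>\<^bsub>R\<^esub>)"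

lemma submodule_free_module_finsum:
  fixes R (structure)
  assumes "ring R" and I: "submodule I R (free_module R S)" and "finite P"
    and "\<And>p. p \<in> P \<Longrightarrow> c p \<in> I"
  shows "(\<lambda>s. \<Oplus>p\<in>P. c p s) \<in> I"
  using assms(3,4)
proof (induction P)
  interpret ring R by fact
  case empty
  then show ?case
    using submoduleD(2)[OF I] by (simp add: free_module_def)
next
  interpret ring R by fact
  case (insert q P)
  have "c p s \<in> carrier R" if "p \<in> insert q P" for p s
    using insert.prems[OF that] submoduleD(1)[OF I] by (auto simp: free_module_def)
  then have "(\<lambda>s. \<Oplus>p\<in>insert q P. c p s) = c q \<oplus>\<^bsub>free_module R S\<^esub> (\<lambda>s. \<Oplus>p\<in>P. c p s)"
    using insert.hyps by (subst finsum_insert) (auto simp: free_module_def Pi_def)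
  then show ?case
    using insert submoduleD(3)[OF I] by auto
qed

text \<open>In a group, one factor of a product \<open>h = p q\<close> determines the other, so the convolution is a linear
  combination of translates. The index set may be any finite set that contains the support,
  which allows a singleton even for a coefficient that vanishes.\<close>

lemma group_algebra_mult:
  fixes R (structure)
  assumes "ring R" and "group H"
    and \<phi>: "\<phi> \<in> carrier (free_module R (carrier H))"
    and \<psi>: "\<psi> \<in> carrier (free_module R (carrier H))"
    and P: "finite P" "{p. \<phi> p \<noteq> \<zero>} \<subseteq> P" "P \<subseteq> carrier H"
  shows "\<phi> \<otimes>\<^bsub>group_algebra R H\<^esub> \<psi> = (\<lambda>h. \<Oplus>p\<in>P. \<phi> p \<otimes> left_translate R H p \<psi> h)"
proof
  interpret ring R by fact
  interpret H: group H by fact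
  fix h
  let ?S = "{(p, q). \<phi> p \<noteq> \<zero> \<and> \<psi> q \<noteq> \<zero> \<and> p \<otimes>\<^bsub>H\<^esub> q = h}"
  have carr: "\<phi> p \<in> carrier R" "\<psi> p \<in> carrier R" for p
    using \<phi> \<psi> by (auto simp: free_module_def)
  have S: "p \<in> carrier H" "q \<in> carrier H" "h \<in> carrier H" "q = inv\<^bsub>H\<^esub> p \<otimes>\<^bsub>H\<^esub> h" "p \<in> P"
    if "(p, q) \<in> ?S" for p q
  proof -
    show pq: "p \<in> carrier H" "q \<in> carrier H" "p \<in> P"
      using that \<phi> \<psi> P(2) by (auto simp: free_module_def)
    then show "h \<in> carrier H" "q = inv\<^bsub>H\<^esub> p \<otimes>\<^bsub>H\<^esub> h"
      using that by (auto simp: H.m_assoc[symmetric])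
  qed
  have inj: "inj_on fst ?S"
  proof (rule inj_onI)
    fix s t assume st: "s \<in> ?S" "t \<in> ?S" "fst s = fst t"
    have mem: "(fst s, snd s) \<in> ?S" "(fst t, snd t) \<in> ?S"
      unfolding prod.collapse by (fact st(1,2))+
    have "snd s = snd t"
      using S(4)[OF mem(1)] S(4)[OF mem(2)] st(3) by simp
    with st show "s = t" by (simp add: prod_eq_iff)
  qed
  have "(\<phi> \<otimes>\<^bsub>group_algebra R H\<^esub> \<psi>) h = (\<Oplus>s\<in>?S. \<phi> (fst s) \<otimes> \<psi> (snd s))"
    by (simp add: group_algebra_def)
  also have "\<dots> = (\<Oplus>s\<in>?S. \<phi> (fst s) \<otimes> left_translate R H (fst s) \<psi> h)"
    using S(3,4) by (intro finsum_cong') (auto simp: left_translate_def carr)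
  also have "\<dots> = (\<Oplus>p\<in>fst ` ?S. \<phi> p \<otimes> left_translate R H p \<psi> h)"
    using inj by (subst finsum_reindex) (auto simp: left_translate_def carr)
  also have "\<dots> = (\<Oplus>p\<in>P. \<phi> p \<otimes> left_translate R H p \<psi> h)"
  proof (rule add.finprod_mono_neutral_cong_left)
    fix p assume p: "p \<in> P - fst ` ?S"
    have "\<phi> p = \<zero> \<or> left_translate R H p \<psi> h = \<zero>"
    proof (rule ccontr)
      assume neg: "\<not> ?thesis"
      then have "h \<in> carrier H" by (auto simp: left_translate_def split: if_splits)
      then have "(p, inv\<^bsub>H\<^esub> p \<otimes>\<^bsub>H\<^esub> h) \<in> ?S"
        using neg p P(3) by (auto simp: left_translate_def H.m_assoc[symmetric])
      then show False using p by force
    qed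
    then show "\<phi> p \<otimes> left_translate R H p \<psi> h = \<zero>"
      using carr by (auto simp: left_translate_def)
  qed (use P S(5) carr in \<open>auto simp: left_translate_def\<close>)
  finally show "(\<phi> \<otimes>\<^bsub>group_algebra R H\<^esub> \<psi>) h = (\<Oplus>p\<in>P. \<phi> p \<otimes> left_translate R H p \<psi> h)" .
qed

lemma left_translate_closed:
  assumes "ring R" and "group H" and "p \<in> carrier H"
    and \<phi>: "\<phi> \<in> carrier (free_module R (carrier H))"
  shows "left_translate R H p \<phi> \<in> carrier (free_module R (carrier H))"
proof -
  interpret R: ring R by fact
  interpret group H by fact
  have "{h. left_translate R H p \<phi> h \<noteq> \<zero>\<^bsub>R\<^esub>} \<subseteq> (\<lambda>q. p \<otimes>\<^bsub>H\<^esub> q) ` {q. \<phi> q \<noteq> \<zero>\<^bsub>R\<^esub>}"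
  proof
    fix h assume "h \<in> {h. left_translate R H p \<phi> h \<noteq> \<zero>\<^bsub>R\<^esub>}"
    then have "h = p \<otimes>\<^bsub>H\<^esub> (inv\<^bsub>H\<^esub> p \<otimes>\<^bsub>H\<^esub> h)" "\<phi> (inv\<^bsub>H\<^esub> p \<otimes>\<^bsub>H\<^esub> h) \<noteq> \<zero>\<^bsub>R\<^esub>"
      using assms(3) by (auto simp: left_translate_def m_assoc[symmetric] split: if_splits)
    then show "h \<in> (\<lambda>q. p \<otimes>\<^bsub>H\<^esub> q) ` {q. \<phi> q \<noteq> \<zero>\<^bsub>R\<^esub>}" by blast
  qed
  then have "finite {h. left_translate R H p \<phi> h \<noteq> \<zero>\<^bsub>R\<^esub>}"
    using \<phi> by (auto simp: free_module_def intro: finite_surj)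
  then show ?thesis
    using \<phi> by (auto simp: free_module_def left_translate_def Pi_def split: if_splits)
qed

lemma left_translate_one:
  assumes "group H" and c: "c \<in> carrier (free_module R' (carrier H))"
  shows "left_translate R' H \<one>\<^bsub>H\<^esub> c = c"
proof
  interpret group H by fact
  show "left_translate R' H \<one>\<^bsub>H\<^esub> c h = c h" for h
    using free_moduleD(2)[OF c, of h] by (simp add: left_translate_def)
qed

lemma left_translate_zero: "left_translate R H p (\<lambda>_. \<zero>\<^bsub>R\<^esub>) = (\<lambda>_. \<zero>\<^bsub>R\<^esub>)"
  by (simp add: left_translate_def fun_eq_iff)

text \<open>A left ideal is closed under multiplication by the elements \<open>a p\<close> with \<open>a\<close> a scalar and \<open>p\<close> in
  the group, which gives scalar multiples (at the identity) and translates (at \<open>a = 1\<close>); these in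
  turn span the algebra.\<close>

lemma left_ideal_group_algebra_iff:
  fixes R (structure)
  assumes R: "ring R" and H: "group H"
  shows "left_ideal I (group_algebra R H) \<longleftrightarrow>
    submodule I R (free_module R (carrier H)) \<and>
    (\<forall>p\<in>carrier H. \<forall>\<phi>\<in>I. left_translate R H p \<phi> \<in> I)"
    (is "?L \<longleftrightarrow> ?S \<and> ?T")
proof
  interpret ring R by fact
  interpret H: group H by fact
  let ?F = "free_module R (carrier H)"
  have carrier_eq: "carrier (group_algebra R H) = carrier ?F"
    by (simp add: group_algebra_def)
  have add_eq: "add_monoid (group_algebra R H) = add_monoid ?F"
    by (simp add: group_algebra_def)
  have sub_eq: "additive_subgroup I (group_algebra R H) \<longleftrightarrow> subgroup I (add_monoid ?F)"
    by (simp add: additive_subgroup_def add_eq)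
  {
    assume ?L
    then have I: "subgroup I (add_monoid ?F)"
      and mult: "\<And>\<phi> \<psi>. \<phi> \<in> carrier ?F \<Longrightarrow> \<psi> \<in> I \<Longrightarrow> \<phi> \<otimes>\<^bsub>group_algebra R H\<^esub> \<psi> \<in> I"
      by (auto simp: left_ideal_def sub_eq carrier_eq)
    have IF: "I \<subseteq> carrier ?F"
      using subgroup.subset[OF I] by simp
    have key: "(\<lambda>h. a \<otimes> left_translate R H p \<psi> h) \<in> I"
      if a: "a \<in> carrier R" and p: "p \<in> carrier H" and \<psi>: "\<psi> \<in> I" for a p \<psi>
    proof -
      \<comment> \<open>The element \<open>a p\<close> of the group algebra.\<close>
      let ?\<delta> = "\<lambda>h. if h = p then a else \<zero>"
      have \<delta>: "?\<delta> \<in> carrier ?F"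
        using a p by (auto simp: free_module_def)
      have "\<psi> h \<in> carrier R" for h
        using IF \<psi> by (auto simp: free_module_def)
      then have "?\<delta> \<otimes>\<^bsub>group_algebra R H\<^esub> \<psi> = (\<lambda>h. a \<otimes> left_translate R H p \<psi> h)"
        using p a IF \<psi>
        by (subst group_algebra_mult[OF R H \<delta>, where P = "{p}"]) (auto simp: left_translate_def)
      then show ?thesis
        using mult[OF \<delta> \<psi>] by simp
    qed
    have ?S
      unfolding submodule_def submodule_axioms_def
    proof (intro conjI allI impI I)
      fix a \<psi> assume a: "a \<in> carrier R" and \<psi>: "\<psi> \<in> I"
      have \<psi>F: "\<psi> \<in> carrier ?F"
        using \<psi> IF by blast
      have "(\<lambda>h. a \<otimes> left_translate R H \<one>\<^bsub>H\<^esub> \<psi> h) = a \<odot>\<^bsub>?F\<^esub> \<psi>"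
        using a free_moduleD(1,2)[OF \<psi>F]
        by (auto simp: left_translate_def free_module_def fun_eq_iff)
      then show "a \<odot>\<^bsub>?F\<^esub> \<psi> \<in> I"
        using key[OF a H.one_closed \<psi>] by simp
    qed
    moreover have ?T
    proof (intro ballI)
      fix p \<psi> assume p: "p \<in> carrier H" and \<psi>: "\<psi> \<in> I"
      have "(\<lambda>h. \<one> \<otimes> left_translate R H p \<psi> h) = left_translate R H p \<psi>"
        using \<psi> IF by (auto simp: left_translate_def free_module_def Pi_def)
      then show "left_translate R H p \<psi> \<in> I"
        using key[OF one_closed p \<psi>] by simp
    qed
    ultimately show "?S \<and> ?T" ..
  }
  {
    assume asm: "?S \<and> ?T"
    then have S: ?S and T: "\<And>p \<psi>. p \<in> carrier H \<Longrightarrow> \<psi> \<in> I \<Longrightarrow> left_translate R H p \<psi> \<in> I"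
      by auto
    show ?L
      unfolding left_ideal_def sub_eq carrier_eq
    proof (intro conjI ballI)
      show "subgroup I (add_monoid ?F)"
        using S by (simp add: submodule_def)
      fix \<phi> \<psi> assume \<phi>: "\<phi> \<in> carrier ?F" and \<psi>: "\<psi> \<in> I"
      have \<psi>F: "\<psi> \<in> carrier ?F"
        using \<psi> submoduleD(1)[OF S] by blast
      let ?P = "{p. \<phi> p \<noteq> \<zero>}"
      have P: "finite ?P" "?P \<subseteq> carrier H"
        using \<phi> by (auto simp: free_module_def)
      have "(\<lambda>h. \<phi> p \<otimes> left_translate R H p \<psi> h) \<in> I" if "p \<in> ?P" for p
        using submoduleD(4)[OF S _ T[OF _ \<psi>], of "\<phi> p" p] \<phi> P(2) that
        by (auto simp: free_module_def)
      then show "\<phi> \<otimes>\<^bsub>group_algebra R H\<^esub> \<psi> \<in> I"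
        using submodule_free_module_finsum[OF R S P(1)]
        by (subst group_algebra_mult[OF R H \<phi> \<psi>F P(1) _ P(2)]) auto
    qed
  }
qed

text \<open>Pulling functions back along an isomorphism \<open>\<tau> : H \<rightarrow> K\<close> maps \<open>k[K]\<close> linearly onto \<open>k[H]\<close> and
  commutes with translation, so preimages of left ideals are left ideals, and distinct left ideals
  have distinct preimages.\<close>

lemma left_noetherian_group_algebra_iso:
  fixes R (structure)
  assumes R: "ring R" and H: "group H" and K: "group K" and "H \<cong> K"
    and noeth: "left_noetherian (group_algebra R K)"
  shows "left_noetherian (group_algebra R H)"
  unfolding left_noetherian_def
proof (intro allI impI)
  interpret ring R by fact
  interpret H: group H by fact
  interpret K: group K by fact
  let ?H = "free_module R (carrier H)" and ?K = "free_module R (carrier K)"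
  obtain \<tau> where \<tau>: "\<tau> \<in> hom H K" "bij_betw \<tau> (carrier H) (carrier K)"
    using \<open>H \<cong> K\<close> by (auto simp: is_iso_def iso_def)
  define push where "push = (\<lambda>\<psi> h. if h \<in> carrier H then \<psi> (\<tau> h) else \<zero>)"
  have push_closed: "push \<psi> \<in> carrier ?H" if "\<psi> \<in> carrier ?K" for \<psi>
  proof -
    have "{h. push \<psi> h \<noteq> \<zero>} = \<tau> -` {k. \<psi> k \<noteq> \<zero>} \<inter> carrier H"
      by (auto simp: push_def)
    moreover have "finite (\<tau> -` {k. \<psi> k \<noteq> \<zero>} \<inter> carrier H)"
      using that \<tau>(2) by (intro finite_vimage_IntI) (auto simp: free_module_def bij_betw_def)
    ultimately show ?thesis
      using that by (auto simp: free_module_def push_def)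
  qed
  have push_linear: "push \<in> linear_maps R ?K ?H"
    unfolding linear_maps_def using push_closed
    by (auto simp: push_def free_module_def)
  have push_surj: "push ` carrier ?K = carrier ?H"
  proof
    show "push ` carrier ?K \<subseteq> carrier ?H" using push_closed by blast
    show "carrier ?H \<subseteq> push ` carrier ?K"
    proof
      fix \<phi> assume \<phi>: "\<phi> \<in> carrier ?H"
      let ?\<psi> = "\<lambda>k. if k \<in> carrier K then \<phi> (inv_into (carrier H) \<tau> k) else \<zero>"
      have "{k. ?\<psi> k \<noteq> \<zero>} \<subseteq> \<tau> ` {h. \<phi> h \<noteq> \<zero>}"
        using \<tau>(2) by (auto simp: bij_betw_inv_into_right image_iff split: if_splits)
          (metis bij_betw_inv_into_right)
      moreover have "finite {h. \<phi> h \<noteq> \<zero>}"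
        using \<phi> by (simp add: free_module_def)
      ultimately have "finite {k. ?\<psi> k \<noteq> \<zero>}"
        by (rule finite_surj[rotated])
      then have "?\<psi> \<in> carrier ?K"
        using \<phi> by (auto simp: free_module_def)
      moreover have "push ?\<psi> = \<phi>"
        using free_moduleD(2)[OF \<phi>] bij_betwE[OF \<tau>(2)] bij_betw_inv_into_left[OF \<tau>(2)]
        by (auto simp: push_def fun_eq_iff)
      ultimately show "\<phi> \<in> push ` carrier ?K"
        by (intro image_eqI[where x = ?\<psi>]) (simp_all only:)
    qed
  qed
  have push_translate: "push (left_translate R K p \<psi>)
      = left_translate R H (inv_into (carrier H) \<tau> p) (push \<psi>)" if p: "p \<in> carrier K" for p \<psi>
  proof -
    let ?q = "inv_into (carrier H) \<tau> p"
    have q: "?q \<in> carrier H" "\<tau> ?q = p"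
      using \<tau>(2) p by (auto simp: bij_betw_def f_inv_into_f inv_into_into)
    have "\<tau> (inv\<^bsub>H\<^esub> ?q \<otimes>\<^bsub>H\<^esub> h) = inv\<^bsub>K\<^esub> p \<otimes>\<^bsub>K\<^esub> \<tau> h" if "h \<in> carrier H" for h
      using that q group_hom.hom_inv[of H K \<tau> ?q] \<tau>(1)
      by (simp add: hom_mult group_hom_def group_hom_axioms_def H K)
    then show ?thesis
      using q(1) bij_betwE[OF \<tau>(2)] by (auto simp: push_def left_translate_def fun_eq_iff)
  qed
  fix I assume I: "(\<forall>i. left_ideal (I i) (group_algebra R H)) \<and> (\<forall>i. I i \<subseteq> I (Suc i))"
  define J where "J = (\<lambda>i. {\<psi> \<in> carrier ?K. push \<psi> \<in> I i})"
  have Isub: "submodule (I i) R ?H" for i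
    using I left_ideal_group_algebra_iff[OF R H] by blast
  have IJ: "I i = push ` J i" for i
    using submoduleD(1)[OF Isub, of i] unfolding push_surj[symmetric] J_def by auto
  have "left_ideal (J i) (group_algebra R K)" for i
  proof -
    have "submodule (J i) R ?K"
      unfolding J_def
      by (rule submodule_vimage[OF left_module_free_module left_module_free_module])
        (use R push_linear Isub in auto)
    moreover have "left_translate R K p \<psi> \<in> J i" if "p \<in> carrier K" "\<psi> \<in> J i" for p \<psi>
    proof -
      have "inv_into (carrier H) \<tau> p \<in> carrier H"
        using \<tau>(2) that(1) by (auto simp: bij_betw_def inv_into_into)
      then have "left_translate R H (inv_into (carrier H) \<tau> p) (push \<psi>) \<in> I i"
        using I that(2) left_ideal_group_algebra_iff[OF R H] unfolding J_def by blast
      then show ?thesis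
        using that push_translate[OF that(1)] left_translate_closed[OF R K that(1)]
        unfolding J_def by auto
    qed
    ultimately show ?thesis
      using left_ideal_group_algebra_iff[OF R K] by blast
  qed
  moreover have "\<forall>i. J i \<subseteq> J (Suc i)"
    using I by (auto simp: J_def)
  ultimately obtain n where "\<forall>m\<ge>n. J m = J n"
    using noeth unfolding left_noetherian_def by blast
  then show "\<exists>n. \<forall>m\<ge>n. I m = I n"
    unfolding IJ by metis
qed

lemma product_group_reindex_iso:
  assumes b: "bij_betw b I J"
  shows "product_group J (\<lambda>_. G) \<cong> product_group I (\<lambda>_. G)"
proof -
  let ?\<tau> = "\<lambda>\<gamma>. \<lambda>i\<in>I. \<gamma> (b i)"
  have "?\<tau> \<in> hom (product_group J (\<lambda>_. G)) (product_group I (\<lambda>_. G))"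
    using bij_betwE[OF b] by (auto simp: hom_def fun_eq_iff)
  moreover have "bij_betw ?\<tau> (J \<rightarrow>\<^sub>E carrier G) (I \<rightarrow>\<^sub>E carrier G)"
  proof (rule bij_betw_byWitness[where f' = "\<lambda>\<gamma>. \<lambda>j\<in>J. \<gamma> (inv_into I b j)"])
    show "\<forall>\<gamma>\<in>J \<rightarrow>\<^sub>E carrier G. (\<lambda>j\<in>J. ?\<tau> \<gamma> (inv_into I b j)) = \<gamma>"
      using bij_betw_inv_into_right[OF b] bij_betwE[OF bij_betw_inv_into[OF b]]
      by (auto simp: fun_eq_iff PiE_def extensional_def)
    show "\<forall>\<gamma>\<in>I \<rightarrow>\<^sub>E carrier G. ?\<tau> (\<lambda>j\<in>J. \<gamma> (inv_into I b j)) = \<gamma>"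
      using bij_betw_inv_into_left[OF b] bij_betwE[OF b]
      by (auto simp: fun_eq_iff PiE_def extensional_def)
    show "?\<tau> ` (J \<rightarrow>\<^sub>E carrier G) \<subseteq> I \<rightarrow>\<^sub>E carrier G"
      using bij_betwE[OF b] by (auto simp: PiE_def Pi_def)
    show "(\<lambda>\<gamma>. \<lambda>j\<in>J. \<gamma> (inv_into I b j)) ` (I \<rightarrow>\<^sub>E carrier G) \<subseteq> J \<rightarrow>\<^sub>E carrier G"
      using bij_betwE[OF bij_betw_inv_into[OF b]] by (auto simp: PiE_def Pi_def)
  qed
  ultimately show ?thesis
    by (auto simp: is_iso_def iso_def)
qed

section \<open>Blocks of coefficients in the principal projectives of FI\<close>

lemma Obj_FI [simp]: "A \<in> Obj (FI G) \<longleftrightarrow> finite A"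
  by (simp add: FI_def)

lemma Arr_FI [simp]: "(f, \<rho>) \<in> Arr (FI G) A B \<longleftrightarrow>
    f \<in> A \<rightarrow>\<^sub>E B \<and> \<rho> \<in> A \<rightarrow>\<^sub>E carrier G \<and> inj_on f A"
  by (auto simp: FI_def G_maps_def)

lemma Comp_FI [simp]: "Comp (FI G) A B D (g, \<sigma>) (f, \<rho>)
    = (\<lambda>a\<in>A. g (f a), \<lambda>a\<in>A. \<sigma> (f a) \<otimes>\<^bsub>G\<^esub> \<rho> a)"
  by (simp add: FI_def)

lemma restrict_comp_eqD:
  assumes "inj_on g B" and "f \<in> A \<rightarrow>\<^sub>E B" and "f' \<in> A \<rightarrow>\<^sub>E B"
    and "(\<lambda>a\<in>A. g (f a)) = (\<lambda>a\<in>A. g (f' a))"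
  shows "f = f'"
proof (rule PiE_ext[OF assms(2,3)])
  fix a assume a: "a \<in> A"
  then have "g (f a) = g (f' a)"
    using fun_cong[OF assms(4), of a] by simp
  with a show "f a = f' a"
    using assms(2,3) by (auto intro: inj_onD[OF assms(1)])
qed

lemma monic_category_FI:
  assumes "group G"
  shows "monic_category (FI G :: ('x set, ('x, 'g) gmap) category)"
proof -
  interpret group G by fact
  interpret category "FI G :: ('x set, ('x, 'g) gmap) category"
    by (rule category_FI) fact
  show ?thesis
  proof (unfold_locales, rule inj_onI)
    fix A B D :: "'x set" and h k k' :: "('x, 'g) gmap"
    assume arr: "h \<in> Arr (FI G) B D" "k \<in> Arr (FI G) A B" "k' \<in> Arr (FI G) A B"
      and eq: "Comp (FI G) A B D h k = Comp (FI G) A B D h k'"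
    obtain g \<sigma> f \<rho> f' \<rho>' where [simp]: "h = (g, \<sigma>)" "k = (f, \<rho>)" "k' = (f', \<rho>')"
      by (cases h, cases k, cases k')
    have f: "f = f'"
    proof (rule restrict_comp_eqD)
      show "inj_on g B" "f \<in> A \<rightarrow>\<^sub>E B" "f' \<in> A \<rightarrow>\<^sub>E B"
        using arr by simp_all
      show "(\<lambda>a\<in>A. g (f a)) = (\<lambda>a\<in>A. g (f' a))"
        using eq by simp
    qed
    have "\<rho> = \<rho>'"
    proof (rule PiE_ext[of _ A "\<lambda>_. carrier G"])
      fix a assume a: "a \<in> A"
      have "(\<lambda>a\<in>A. \<sigma> (f a) \<otimes>\<^bsub>G\<^esub> \<rho> a) = (\<lambda>a\<in>A. \<sigma> (f a) \<otimes>\<^bsub>G\<^esub> \<rho>' a)"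
        using eq f by simp
      from fun_cong[OF this, of a] a have "\<sigma> (f a) \<otimes>\<^bsub>G\<^esub> \<rho> a = \<sigma> (f a) \<otimes>\<^bsub>G\<^esub> \<rho>' a"
        by simp
      moreover have "\<sigma> (f a) \<in> carrier G" "\<rho> a \<in> carrier G" "\<rho>' a \<in> carrier G"
        using arr a by (auto simp: PiE_def Pi_def)
      ultimately show "\<rho> a = \<rho>' a" by simp
    qed (use arr in auto)
    with f show "k = k'" by simp
  qed
qed

lemma FI_iso:
  assumes "group G" and "finite A" and h: "bij_betw h A B"
  obtains f g where "f \<in> Arr (FI G) A B" "g \<in> Arr (FI G) B A"
    "Comp (FI G) A B A g f = Ident (FI G) A"
proof -
  interpret group G by fact
  define k where "k = inv_into A h"
  have k: "bij_betw k B A" "\<And>a. a \<in> A \<Longrightarrow> k (h a) = a"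
    using bij_betw_inv_into[OF h] bij_betw_inv_into_left[OF h] by (auto simp: k_def)
  have hB: "\<And>a. a \<in> A \<Longrightarrow> h a \<in> B" using bij_betwE[OF h] by blast
  show ?thesis
  proof
    show "(\<lambda>a\<in>A. h a, \<lambda>_\<in>A. \<one>\<^bsub>G\<^esub>) \<in> Arr (FI G) A B"
      using h bij_betwE[OF h] by (auto simp: bij_betw_def inj_on_def)
    show "(\<lambda>b\<in>B. k b, \<lambda>_\<in>B. \<one>\<^bsub>G\<^esub>) \<in> Arr (FI G) B A"
      using k(1) bij_betwE[OF k(1)] by (auto simp: bij_betw_def inj_on_def)
    show "Comp (FI G) A B A (\<lambda>b\<in>B. k b, \<lambda>_\<in>B. \<one>\<^bsub>G\<^esub>) (\<lambda>a\<in>A. h a, \<lambda>_\<in>A. \<one>\<^bsub>G\<^esub>) = Ident (FI G) A"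
      using k(2) hB by (auto simp: FI_def fun_eq_iff)
  qed
qed

text \<open>A block of \<open>\<phi> \<in> P\<^sub>A(B)\<close> is the function \<open>\<rho> \<mapsto> \<phi> (f, \<rho>)\<close>, that is \<open>curry \<phi> f\<close>, viewed as an
  element of \<open>k[G\<^sup>A]\<close>. The next two lemmas describe the blocks of \<open>(g, \<sigma>) \<phi>\<close>: the composite of
  \<open>(f, \<rho>)\<close> with \<open>(g, \<sigma>)\<close> is \<open>(g \<circ> f, (\<sigma> \<circ> f) \<rho>)\<close>, so the block of \<open>f\<close> is translated by \<open>\<sigma> \<circ> f\<close> and put
  at \<open>g \<circ> f\<close>, and nothing arrives at an injection that does not factor through \<open>g\<close>.\<close>

context
  fixes G :: "('g, 'b) monoid_scheme" and R :: "('k, 'c) ring_scheme"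
    and A B D :: "'x set" and g :: "'x \<Rightarrow> 'x" and \<sigma> :: "'x \<Rightarrow> 'g"
    and \<phi> :: "('x, 'g) gmap \<Rightarrow> 'k"
  assumes G: "group G" and R: "ring R" and fin: "finite A" "finite B" "finite D"
    and g\<sigma>: "(g, \<sigma>) \<in> Arr (FI G) B D"
    and \<phi>: "\<phi> \<in> carrier (free_module R (Arr (FI G) A B))"
begin

interpretation group G by (rule G)
interpretation R: ring R by (rule R)
interpretation monic_category "FI G :: ('x set, ('x, 'g) gmap) category"
  by (rule monic_category_FI) (rule G)

lemma block_of_map:
  assumes f: "f \<in> A \<rightarrow>\<^sub>E B" "inj_on f A"
  shows "curry (RepMap (principal_projective (FI G) R A) B D (g, \<sigma>) \<phi>) (\<lambda>a\<in>A. g (f a))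
    = left_translate R (product_group A (\<lambda>_. G)) (\<lambda>a\<in>A. \<sigma> (f a)) (curry \<phi> f)"
proof
  let ?H = "product_group A (\<lambda>_. G)" and ?\<psi> = "RepMap (principal_projective (FI G) R A) B D (g, \<sigma>) \<phi>"
  have \<sigma>f: "\<sigma> (f a) \<in> carrier G" if "a \<in> A" for a
    using g\<sigma> f that by auto
  then have \<sigma>f': "(\<lambda>a\<in>A. \<sigma> (f a)) \<in> carrier ?H"
    by auto
  have obj: "A \<in> Obj (FI G)" "B \<in> Obj (FI G)" "D \<in> Obj (FI G)"
    using fin by auto
  fix \<rho>'
  show "curry ?\<psi> (\<lambda>a\<in>A. g (f a)) \<rho>'
      = left_translate R ?H (\<lambda>a\<in>A. \<sigma> (f a)) (curry \<phi> f) \<rho>'"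
  proof (cases "\<rho>' \<in> carrier ?H")
    case True
    \<comment> \<open>The only labelling of \<open>f\<close> that \<open>(g, \<sigma>)\<close> carries to \<open>\<rho>'\<close>.\<close>
    let ?\<rho> = "\<lambda>a\<in>A. inv\<^bsub>G\<^esub> (\<sigma> (f a)) \<otimes>\<^bsub>G\<^esub> \<rho>' a"
    have \<rho>: "inv\<^bsub>?H\<^esub> (\<lambda>a\<in>A. \<sigma> (f a)) \<otimes>\<^bsub>?H\<^esub> \<rho>' = ?\<rho>"
      using \<sigma>f' G by (auto simp: fun_eq_iff)
    have "(f, ?\<rho>) \<in> Arr (FI G) A B"
      using f \<sigma>f True by auto
    note principal_projective_map_Comp[OF R obj g\<sigma> \<phi> this]
    moreover have "Comp (FI G) A B D (g, \<sigma>) (f, ?\<rho>) = (\<lambda>a\<in>A. g (f a), \<rho>')"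
      using True \<sigma>f by (auto simp: fun_eq_iff m_assoc[symmetric] PiE_def Pi_def extensional_def)
    ultimately show ?thesis
      unfolding left_translate_def \<rho> using True by simp
  next
    case False
    then have "((\<lambda>a\<in>A. g (f a)), \<rho>') \<notin> Arr (FI G) A D"
      by simp
    then have "?\<psi> ((\<lambda>a\<in>A. g (f a)), \<rho>') = \<zero>\<^bsub>R\<^esub>"
      by (rule free_moduleD(2)[OF principal_projective_map_closed[OF R obj g\<sigma> \<phi>]])
    then show ?thesis
      unfolding left_translate_def using False by simp
  qed
qed

lemma block_of_map_off_image:
  assumes "\<And>f. f \<in> A \<rightarrow>\<^sub>E B \<Longrightarrow> inj_on f A \<Longrightarrow> f' \<noteq> (\<lambda>a\<in>A. g (f a))"
  shows "curry (RepMap (principal_projective (FI G) R A) B D (g, \<sigma>) \<phi>) f' = (\<lambda>_. \<zero>\<^bsub>R\<^esub>)"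
proof
  fix \<rho>'
  have "(f', \<rho>') \<notin> Comp (FI G) A B D (g, \<sigma>) ` Arr (FI G) A B"
  proof
    assume "(f', \<rho>') \<in> Comp (FI G) A B D (g, \<sigma>) ` Arr (FI G) A B"
    then obtain k where k: "k \<in> Arr (FI G) A B" "(f', \<rho>') = Comp (FI G) A B D (g, \<sigma>) k"
      by blast
    obtain f \<rho> where "k = (f, \<rho>)" by (cases k)
    with k show False using assms[of f] by simp
  qed
  then show "curry (RepMap (principal_projective (FI G) R A) B D (g, \<sigma>) \<phi>) f' \<rho>' = \<zero>\<^bsub>R\<^esub>"
    using principal_projective_map_off_image[OF R _ _ _ g\<sigma> \<phi>] fin by simp
qed

end

lemma block_linear:
  "(\<lambda>\<phi>. curry \<phi> f) \<in> linear_maps R (free_module R (Arr (FI G) A B))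
    (free_module R (carrier (product_group A (\<lambda>_. G))))"
proof -
  have "curry \<phi> f \<in> carrier (free_module R (carrier (product_group A (\<lambda>_. G))))"
    if \<phi>: "\<phi> \<in> carrier (free_module R (Arr (FI G) A B))" for \<phi>
  proof -
    have "finite (snd ` {h. \<phi> h \<noteq> \<zero>\<^bsub>R\<^esub>})"
      using free_moduleD(3)[OF \<phi>] by simp
    moreover have "{\<rho>. \<phi> (f, \<rho>) \<noteq> \<zero>\<^bsub>R\<^esub>} \<subseteq> snd ` {h. \<phi> h \<noteq> \<zero>\<^bsub>R\<^esub>}"
      by force
    ultimately have "finite {\<rho>. \<phi> (f, \<rho>) \<noteq> \<zero>\<^bsub>R\<^esub>}"
      by (rule finite_subset[rotated])
    moreover have "\<rho> \<in> A \<rightarrow>\<^sub>E carrier G" if "\<phi> (f, \<rho>) \<noteq> \<zero>\<^bsub>R\<^esub>" for \<rho>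
      using free_moduleD(2)[OF \<phi>, of "(f, \<rho>)"] that by auto
    ultimately show ?thesis
      using free_moduleD(1)[OF \<phi>] by (auto simp: free_module_def)
  qed
  then show ?thesis
    by (auto simp: linear_maps_def) (auto simp: free_module_def fun_eq_iff)
qed

section \<open>Noetherian representations give noetherian group algebras\<close>

text \<open>A left ideal \<open>I\<close> is mapped to the subrepresentation of all elements whose blocks lie in \<open>I\<close>; closure
  under morphisms is exactly closure of \<open>I\<close> under translation. At the object \<open>A\<close> itself, the blocks at
  the identity recover \<open>I\<close>, so a chain of left ideals is as long as its image.\<close>

lemma left_noetherian_of_principal_projective:
  fixes A :: "'x set"
  assumes G: "group G" and R: "ring R" and A: "finite A"
    and noeth: "noetherian_rep (FI G) R (principal_projective (FI G) R A)"
  shows "left_noetherian (group_algebra R (product_group A (\<lambda>_. G)))"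
  unfolding left_noetherian_def
proof (intro allI impI)
  let ?H = "product_group A (\<lambda>_. G)" and ?P = "principal_projective (FI G) R A"
  interpret G: group G by (rule G)
  interpret R: ring R by (rule R)
  have H: "group ?H"
    using G by simp
  fix I assume I: "(\<forall>i. left_ideal (I i) (group_algebra R ?H)) \<and> (\<forall>i. I i \<subseteq> I (Suc i))"
  have Isub: "submodule (I i) R (free_module R (carrier ?H))"
    and Itr: "p \<in> carrier ?H \<Longrightarrow> \<psi> \<in> I i \<Longrightarrow> left_translate R ?H p \<psi> \<in> I i" for i p \<psi>
    using I left_ideal_group_algebra_iff[OF R H] by blast+
  have I0: "(\<lambda>_. \<zero>\<^bsub>R\<^esub>) \<in> I i" for i
    using submoduleD(2)[OF Isub] by (simp add: free_module_def)
  define N where "N = (\<lambda>i B. {\<phi> \<in> carrier (free_module R (Arr (FI G) A B)). \<forall>f. curry \<phi> f \<in> I i})"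
  have Mod [simp]: "RepMod ?P B = free_module R (Arr (FI G) A B)" for B
    by (simp add: principal_projective_def)
  have "subrepresentation (FI G) R ?P (N i)" for i
    unfolding subrepresentation_def
  proof (intro conjI ballI)
    fix B :: "'x set"
    interpret M: left_module R "free_module R (Arr (FI G) A B)"
      by (rule left_module_free_module[OF R])
    note block = linear_mapsD[OF block_linear[where R = R and G = G and A = A and B = B]]
    show "submodule (N i B) R (RepMod ?P B)"
      unfolding Mod
    proof (rule M.submodule_intro)
      have "curry (\<zero>\<^bsub>free_module R (Arr (FI G) A B)\<^esub>) f \<in> I i" for f
        using I0 by (simp add: free_module_def curry_def)
      then show "\<zero>\<^bsub>free_module R (Arr (FI G) A B)\<^esub> \<in> N i B"
        by (simp add: N_def)
    next
      fix a v assume "a \<in> carrier R" "v \<in> N i B"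
      then show "a \<odot>\<^bsub>free_module R (Arr (FI G) A B)\<^esub> v \<in> N i B"
        unfolding N_def using block(3) submoduleD(4)[OF Isub]
        by (auto simp: M.smult_closed)
    next
      fix u v assume "u \<in> N i B" "v \<in> N i B"
      then show "u \<oplus>\<^bsub>free_module R (Arr (FI G) A B)\<^esub> v \<in> N i B"
        unfolding N_def using block(2) submoduleD(3)[OF Isub] by auto
    qed (auto simp: N_def)
  next
    fix B D :: "'x set" and h
    assume BD: "B \<in> Obj (FI G)" "D \<in> Obj (FI G)" and h: "h \<in> Arr (FI G) B D"
    obtain g \<sigma> where [simp]: "h = (g, \<sigma>)" by (cases h)
    show "RepMap ?P B D h ` N i B \<subseteq> N i D"
    proof
      fix \<psi> assume "\<psi> \<in> RepMap ?P B D h ` N i B"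
      then obtain \<phi> where \<psi>: "\<psi> = RepMap ?P B D h \<phi>"
        and \<phi>: "\<phi> \<in> carrier (free_module R (Arr (FI G) A B))" "\<And>f. curry \<phi> f \<in> I i"
        by (auto simp: N_def)
      have "curry \<psi> f' \<in> I i" for f'
      proof (cases "\<exists>f\<in>A \<rightarrow>\<^sub>E B. inj_on f A \<and> f' = (\<lambda>a\<in>A. g (f a))")
        case True
        then obtain f where f: "f \<in> A \<rightarrow>\<^sub>E B" "inj_on f A" "f' = (\<lambda>a\<in>A. g (f a))" by blast
        have "(\<lambda>a\<in>A. \<sigma> (f a)) \<in> carrier ?H"
          using h f by auto
        then show ?thesis
          using block_of_map[OF G R A _ _ _ \<phi>(1) f(1,2)] BD h Itr[OF _ \<phi>(2)] f(3) \<psi> by simp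
      next
        case False
        have "curry \<psi> f' = (\<lambda>_. \<zero>\<^bsub>R\<^esub>)"
          unfolding \<psi> \<open>h = (g, \<sigma>)\<close>
          by (rule block_of_map_off_image[OF G R A _ _ _ \<phi>(1)]) (use False BD h in auto)
        then show ?thesis using I0 by simp
      qed
      moreover have "\<psi> \<in> carrier (free_module R (Arr (FI G) A D))"
        using monic_category.principal_projective_map_closed[OF monic_category_FI[OF G] R _ BD h \<phi>(1)] A \<psi>
        by simp
      ultimately show "\<psi> \<in> N i D" by (simp add: N_def)
    qed
  qed
  moreover have "\<forall>i. \<forall>B\<in>Obj (FI G). N i B \<subseteq> N (Suc i) B"
    using I by (auto simp: N_def)
  ultimately obtain n where n: "\<forall>m\<ge>n. \<forall>B\<in>Obj (FI G). N m B = N n B"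
    using noeth unfolding noetherian_rep_def by blast
  let ?id = "\<lambda>a\<in>A. a"
  have "I i = (\<lambda>\<phi>. curry \<phi> ?id) ` N i A" for i
  proof
    show "(\<lambda>\<phi>. curry \<phi> ?id) ` N i A \<subseteq> I i" by (auto simp: N_def)
    show "I i \<subseteq> (\<lambda>\<phi>. curry \<phi> ?id) ` N i A"
    proof
      fix \<psi> assume \<psi>: "\<psi> \<in> I i"
      then have \<psi>F: "\<psi> \<in> carrier (free_module R (carrier ?H))"
        using submoduleD(1)[OF Isub] by blast
      define \<phi> where "\<phi> = (\<lambda>(f, \<rho>). if f = ?id then \<psi> \<rho> else \<zero>\<^bsub>R\<^esub>)"
      have supp: "{h. \<phi> h \<noteq> \<zero>\<^bsub>R\<^esub>} = {?id} \<times> {\<rho>. \<psi> \<rho> \<noteq> \<zero>\<^bsub>R\<^esub>}"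
        by (auto simp: \<phi>_def split: if_splits)
      have "\<phi> \<in> carrier (free_module R (Arr (FI G) A A))"
        unfolding free_module_def using \<psi>F
        by (simp add: supp) (auto simp: \<phi>_def free_module_def)
      moreover have "curry \<phi> f = (if f = ?id then \<psi> else (\<lambda>_. \<zero>\<^bsub>R\<^esub>))" for f
        by (auto simp: \<phi>_def)
      ultimately show "\<psi> \<in> (\<lambda>\<phi>. curry \<phi> ?id) ` N i A"
        using \<psi> I0 by (intro image_eqI[where x = \<phi>]) (auto simp: N_def)
    qed
  qed
  then show "\<exists>n. \<forall>m\<ge>n. I m = I n"
    using n A by (metis Obj_FI)
qed

section \<open>Well-quasi-orders\<close>

text \<open>A decreasing sequence of natural numbers is constant from the place where it attains its minimum.\<close>

lemma monotone_subsequence: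
  fixes s :: "nat \<Rightarrow> nat"
  shows "\<exists>h :: nat \<Rightarrow> nat. strict_mono h \<and> mono (s \<circ> h)"
proof -
  obtain h where h: "strict_mono (h :: nat \<Rightarrow> nat)" "monoseq (\<lambda>n. s (h n))"
    using seq_monosub by blast
  show ?thesis
  proof (cases "\<forall>m n. m \<le> n \<longrightarrow> s (h m) \<le> s (h n)")
    case True
    with h show ?thesis by (auto simp: mono_def)
  next
    case False
    with h have dec: "s (h n) \<le> s (h m)" if "m \<le> n" for m n
      using that unfolding monoseq_def by blast
    obtain N where N: "\<And>n. s (h N) \<le> s (h n)"
      using ex_has_least_nat[of "\<lambda>_. True" _ "\<lambda>n. s (h n)"] by auto
    then have "s (h (N + n)) = s (h N)" for n
      using dec[of N "N + n"] by (simp add: le_antisym)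
    then have "mono (s \<circ> (\<lambda>n. h (N + n)))" by (simp add: mono_def)
    moreover have "strict_mono (\<lambda>n. h (N + n))"
      using h(1) by (simp add: strict_mono_def)
    ultimately show ?thesis by blast
  qed
qed

text \<open>Dickson's lemma, by thinning out the sequence once for every coordinate.\<close>

lemma simultaneous_monotone_subsequence:
  fixes F :: "'t \<Rightarrow> nat \<Rightarrow> nat"
  assumes "finite T"
  shows "\<exists>h :: nat \<Rightarrow> nat. strict_mono h \<and> (\<forall>t\<in>T. mono (F t \<circ> h))"
  using assms
proof induction
  case empty
  show ?case by (intro exI[where x = id]) (simp add: strict_mono_def)
next
  case (insert t T)
  then obtain h :: "nat \<Rightarrow> nat" where h: "strict_mono h" "\<And>t. t \<in> T \<Longrightarrow> mono (F t \<circ> h)" by blast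
  obtain k :: "nat \<Rightarrow> nat" where k: "strict_mono k" "mono (F t \<circ> h \<circ> k)"
    using monotone_subsequence by blast
  have "mono (F t' \<circ> (h \<circ> k))" if "t' \<in> T" for t'
    using h(2)[OF that] strict_mono_mono[OF k(1)] by (auto simp: mono_def)
  with h(1) k show ?case
    by (intro exI[where x = "h \<circ> k"] conjI ballI strict_mono_o) (auto simp only: o_assoc)
qed

text \<open>The truncated differences of \<open>u\<close> record its order pattern as well as its gaps. If neither
  they nor the entries shrink on passing to \<open>v\<close>, then \<open>v\<close> has the same pattern with wider gaps, and \<open>u\<close> can be stretched
  onto \<open>v\<close>. Such a map moves \<open>t\<close> upwards by the largest displacement \<open>v ! p - u ! p\<close> among the entries
  \<open>u ! p \<le> t\<close>; this grows with \<open>t\<close>, and at \<open>t = u ! q\<close> it is attained by \<open>q\<close>.\<close>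

lemma strict_mono_interpolation:
  fixes u v :: "nat list"
  assumes len: "length u = length v" and "distinct u"
    and le: "\<And>p. p < length u \<Longrightarrow> u ! p \<le> v ! p"
    and gaps: "\<And>p q. p < length u \<Longrightarrow> q < length u \<Longrightarrow> u ! p - u ! q \<le> v ! p - v ! q"
  shows "\<exists>m. strict_mono m \<and> v = map m u"
proof -
  define E where "E = (\<lambda>t. insert 0 ((\<lambda>p. v ! p - u ! p) ` {p. p < length u \<and> u ! p \<le> t}))"
  define m where "m = (\<lambda>t. t + Max (E t))"
  have E: "finite (E t)" "E t \<noteq> {}" for t
    by (auto simp: E_def)
  have "Max (E t) \<le> Max (E t')" if "t \<le> t'" for t t'
    using that by (intro Max_mono E) (auto simp: E_def)
  then have "strict_mono m"
    by (auto simp: strict_mono_def m_def intro!: add_less_le_mono)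
  moreover have "v ! q = m (u ! q)" if q: "q < length u" for q
  proof -
    have "v ! p - u ! p \<le> v ! q - u ! q" if "p < length u" "u ! p \<le> u ! q" for p
    proof (cases "p = q")
      case False
      then have "u ! p < u ! q"
        using \<open>distinct u\<close> q that by (simp add: nth_eq_iff_index_eq order_less_le)
      then show ?thesis
        using gaps[OF q that(1)] le[OF that(1)] by linarith
    qed simp
    then have "Max (E (u ! q)) = v ! q - u ! q"
      using q by (intro Max_eqI E) (auto simp: E_def)
    then show ?thesis
      using le[OF q] by (simp add: m_def)
  qed
  ultimately show ?thesis
    using len by (intro exI[where x = m] conjI nth_equalityI) auto
qed

text \<open>A monomial \<open>i # vs\<close> consists of the index \<open>i\<close> of a summand and the list \<open>vs\<close> of values of an
  injection, and a map of positions acts on the values only.\<close>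

definition shift :: "(nat \<Rightarrow> nat) \<Rightarrow> nat list \<Rightarrow> nat list" where
  "shift m s = hd s # map m (tl s)"

lemma map_less_map:
  fixes m :: "nat \<Rightarrow> nat"
  assumes m: "strict_mono m" and "xs < ys"
  shows "map m xs < map m ys"
  using assms(2)
proof (induction xs ys rule: list_induct2')
  case (4 x xs y ys)
  then show ?case
    using strict_mono_less[OF m] by auto
qed auto

lemma shift_less_shift:
  assumes "strict_mono m" and "s \<noteq> []" and "t \<noteq> []" and "s < t"
  shows "shift m s < shift m t"
  using assms map_less_map[OF assms(1)] by (cases s; cases t) (auto simp: shift_def)

text \<open>The size \<open>n\<close> is treated as an additional entry that exceeds all values. A map that stretches the
  extended list then sends \<open>{0, \<dots>, n - 1}\<close> into the set of the later size.\<close>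

lemma monomials_wqo:
  fixes s :: "nat \<Rightarrow> nat list" and n :: "nat \<Rightarrow> nat" and d :: "nat \<Rightarrow> nat"
  assumes "\<And>j. hd (s j) < r" and len: "\<And>j. length (s j) = Suc (d (hd (s j)))"
    and dist: "\<And>j. distinct (tl (s j))" and bound: "\<And>j. set (tl (s j)) \<subseteq> {..<n j}"
  obtains h :: "nat \<Rightarrow> nat" where "strict_mono h"
    and "\<And>j k. j \<le> k \<Longrightarrow> \<exists>m. strict_mono m \<and> m (n (h j)) = n (h k) \<and> s (h k) = shift m (s (h j))"
proof -
  have "finite (range (\<lambda>j. hd (s j)))"
    using assms(1) by (auto intro: finite_subset[of _ "{..<r}"])
  then obtain j0 where "infinite {j. hd (s j) = hd (s j0)}"
    using pigeonhole_infinite[of UNIV "\<lambda>j. hd (s j)"] by auto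
  from infinite_enumerate[OF this] obtain h1 :: "nat \<Rightarrow> nat"
    where h1: "strict_mono h1" and hd: "\<And>j. hd (s (h1 j)) = hd (s j0)" by auto
  define l where "l = Suc (d (hd (s j0)))"
  define L where "L = (\<lambda>j. n (h1 j) # tl (s (h1 j)))"
  have L: "length (L j) = l" "distinct (L j)" for j
    using len[of "h1 j"] hd[of j] dist[of "h1 j"] bound[of "h1 j"] by (auto simp: L_def l_def)
  \<comment> \<open>The coordinates for Dickson's lemma are all entries and all truncated differences of entries.\<close>
  define T :: "(nat + nat \<times> nat) set" where "T = {..<l} <+> {..<l} \<times> {..<l}"
  define F where "F = (\<lambda>t j. case t of Inl p \<Rightarrow> L j ! p | Inr (p, q) \<Rightarrow> L j ! p - L j ! q)"
  have "finite T" by (simp add: T_def)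
  from simultaneous_monotone_subsequence[OF this, of F] obtain h2 :: "nat \<Rightarrow> nat"
    where h2: "strict_mono h2" "\<And>t. t \<in> T \<Longrightarrow> mono (F t \<circ> h2)" by blast
  show ?thesis
  proof (rule that[of "h1 \<circ> h2"])
    show "strict_mono (h1 \<circ> h2)" by (rule strict_mono_o) fact+
    fix j k :: nat assume jk: "j \<le> k"
    have "\<exists>m. strict_mono m \<and> L (h2 k) = map m (L (h2 j))"
    proof (rule strict_mono_interpolation)
      fix p assume "p < length (L (h2 j))"
      then show "L (h2 j) ! p \<le> L (h2 k) ! p"
        using monoD[OF h2(2)[of "Inl p"] jk] by (auto simp: T_def F_def L)
    next
      fix p q assume "p < length (L (h2 j))" "q < length (L (h2 j))"
      then show "L (h2 j) ! p - L (h2 j) ! q \<le> L (h2 k) ! p - L (h2 k) ! q"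
        using monoD[OF h2(2)[of "Inr (p, q)"] jk] by (auto simp: T_def F_def L)
    qed (simp_all add: L)
    then obtain m where "strict_mono m" "L (h2 k) = map m (L (h2 j))" by blast
    moreover have "s (h1 (h2 k)) = hd (s j0) # tl (s (h1 (h2 k)))"
      using len[of "h1 (h2 k)"] hd[of "h2 k"] by (metis list.collapse list.size(3) nat.distinct(1))
    ultimately show "\<exists>m. strict_mono m \<and> m (n ((h1 \<circ> h2) j)) = n ((h1 \<circ> h2) k)
        \<and> s ((h1 \<circ> h2) k) = shift m (s ((h1 \<circ> h2) j))"
      by (intro exI[where x = m]) (simp add: L_def shift_def hd)
  qed
qed

section \<open>Leading coefficients in a left module\<close>

text \<open>The values of \<open>c s\<close> on those elements of \<open>N\<close> whose coefficients beyond \<open>s\<close> vanish. Elements whose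
  coefficient at \<open>s\<close> vanishes too are included, which makes this set a submodule.\<close>

definition leading_coefficients ::
  "('k, 'c) ring_scheme \<Rightarrow> 's::linorder set \<Rightarrow> ('s \<Rightarrow> 'm \<Rightarrow> 'n \<Rightarrow> 'k) \<Rightarrow> 'm set \<Rightarrow> 's \<Rightarrow> ('n \<Rightarrow> 'k) set"
  where
  "leading_coefficients R S c N s = c s ` {u \<in> N. \<forall>t\<in>S. s < t \<longrightarrow> c t u = (\<lambda>_. \<zero>\<^bsub>R\<^esub>)}"

text \<open>Division with remainder: subtracting from \<open>v \<in> N'\<close> an element of \<open>N\<close> with the same leading
  coefficient makes the leading monomial smaller, and after finitely many steps nothing is left.\<close>

lemma leading_coefficients_determine_submodule:
  fixes S :: "'s::linorder set" and c :: "'s \<Rightarrow> 'm \<Rightarrow> 'n \<Rightarrow> 'k"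
  assumes M: "left_module R M" and N: "submodule N R M" and N': "submodule N' R M" and "N \<subseteq> N'"
    and "finite S" and linear: "\<And>s. s \<in> S \<Longrightarrow> c s \<in> linear_maps R M (free_module R (T s))"
    and inj: "\<And>v. v \<in> carrier M \<Longrightarrow> (\<forall>s\<in>S. c s v = (\<lambda>_. \<zero>\<^bsub>R\<^esub>)) \<Longrightarrow> v = \<zero>\<^bsub>M\<^esub>"
    and leading: "\<And>s. s \<in> S \<Longrightarrow> leading_coefficients R S c N' s \<subseteq> leading_coefficients R S c N s"
  shows "N' = N"
proof
  interpret left_module R M by fact
  note free = left_module_free_module[OF R.ring_axioms]
  define support where "support = (\<lambda>v. {s \<in> S. c s v \<noteq> (\<lambda>_. \<zero>\<^bsub>R\<^esub>)})"
  \<comment> \<open>The measure counts the monomials up to the leading one; the support itself need not shrink.\<close>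
  define below where "below = (\<lambda>v. {s \<in> S. \<exists>t\<in>support v. s \<le> t})"
  have diff: "c s (u \<ominus>\<^bsub>M\<^esub> v) = (\<lambda>_. \<zero>\<^bsub>R\<^esub>)"
    if "s \<in> S" "u \<in> carrier M" "v \<in> carrier M" "c s u = c s v" for s u v
  proof -
    have "c s (u \<ominus>\<^bsub>M\<^esub> v) \<oplus>\<^bsub>free_module R (T s)\<^esub> c s v = c s u"
      using linear_mapsD(2)[OF linear[OF that(1)], of "u \<ominus>\<^bsub>M\<^esub> v" v] that(2,3)
      by (simp add: M.minus_eq M.a_assoc M.l_neg)
    moreover interpret L: left_module R "free_module R (T s)" by (rule free)
    have "c s (u \<ominus>\<^bsub>M\<^esub> v) \<in> carrier (free_module R (T s))" "c s v \<in> carrier (free_module R (T s))"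
      using linear_mapsD(1)[OF linear[OF that(1)]] that(2,3) by simp_all
    ultimately have "c s (u \<ominus>\<^bsub>M\<^esub> v) = \<zero>\<^bsub>free_module R (T s)\<^esub>"
      using that(4) L.M.add.r_cancel_one' by metis
    then show ?thesis by (simp add: free_module_def)
  qed
  have "v \<in> N' \<Longrightarrow> v \<in> N" for v
  proof (induction "card (below v)" arbitrary: v rule: less_induct)
    case less
    have v: "v \<in> carrier M"
      using less.prems submoduleD(1)[OF N'] by blast
    show ?case
    proof (cases "support v = {}")
      case True
      then have "v = \<zero>\<^bsub>M\<^esub>"
        using inj[OF v] by (auto simp: support_def)
      then show ?thesis using submoduleD(2)[OF N] by simp
    next
      case False
      define s where "s = Max (support v)"
      have fin: "finite (support v)" using \<open>finite S\<close> by (simp add: support_def)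
      have s: "s \<in> support v" "s \<in> S"
        using Max_in[OF fin False] by (auto simp: s_def support_def)
      have top: "c t v = (\<lambda>_. \<zero>\<^bsub>R\<^esub>)" if "t \<in> S" "s < t" for t
      proof (rule ccontr)
        assume "c t v \<noteq> (\<lambda>_. \<zero>\<^bsub>R\<^esub>)"
        then have "t \<in> support v" using that by (simp add: support_def)
        then show False using Max_ge[OF fin] that(2) by (auto simp: s_def not_le[symmetric])
      qed
      have "c s v \<in> leading_coefficients R S c N' s"
        using less.prems top by (auto simp: leading_coefficients_def)
      then obtain u where u: "u \<in> N" "c s v = c s u" "\<And>t. t \<in> S \<Longrightarrow> s < t \<Longrightarrow> c t u = (\<lambda>_. \<zero>\<^bsub>R\<^esub>)"
        using leading[OF s(2)] by (auto simp: leading_coefficients_def)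
      have uM: "u \<in> carrier M"
        using u(1) submoduleD(1)[OF N] by blast
      have supp: "t < s" if "t \<in> support (v \<ominus>\<^bsub>M\<^esub> u)" for t
        using that diff[OF _ v uM, of t] u(2,3) top by (force simp: support_def not_less le_less)
      have "below (v \<ominus>\<^bsub>M\<^esub> u) \<subseteq> below v - {s}"
      proof
        fix x assume "x \<in> below (v \<ominus>\<^bsub>M\<^esub> u)"
        then have "x \<in> S" "x < s"
          using supp le_less_trans by (auto simp: below_def)
        then show "x \<in> below v - {s}"
          using s(1) by (auto simp: below_def intro!: bexI[where x = s])
      qed
      moreover have "s \<in> below v" using s by (auto simp: below_def)
      moreover have "finite (below v)" using \<open>finite S\<close> by (simp add: below_def)
      ultimately have "card (below (v \<ominus>\<^bsub>M\<^esub> u)) < card (below v)"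
        by (intro psubset_card_mono) auto
      moreover have "v \<ominus>\<^bsub>M\<^esub> u \<in> N'"
        using less.prems u(1) \<open>N \<subseteq> N'\<close> by (intro submodule_minus N') auto
      ultimately have "v \<ominus>\<^bsub>M\<^esub> u \<in> N" by (rule less.hyps)
      then have "(v \<ominus>\<^bsub>M\<^esub> u) \<oplus>\<^bsub>M\<^esub> u \<in> N"
        using u(1) by (rule submoduleD(3)[OF N])
      then show ?thesis
        using v uM by (simp add: M.minus_eq M.a_assoc M.l_neg)
    qed
  qed
  then show "N' \<subseteq> N" by blast
qed fact

section \<open>Noetherianity of finite sums of principal projectives\<close>

text \<open>The direct sum of the principal projectives at \<open>A 0, \<dots>, A (r - 1)\<close>. The injection \<open>\<iota>\<close> provides
  one finite set of each size, and \<open>e i\<close> enumerates \<open>A i\<close>, so that an injection from \<open>A i\<close> into the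
  standard set \<open>\<iota> ` {..<n}\<close> becomes a list of distinct numbers below \<open>n\<close>.\<close>

locale FI_free_rep =
  fixes G :: "('g, 'b) monoid_scheme" and R :: "('k, 'c) ring_scheme"
    and r :: nat and A :: "nat \<Rightarrow> 'x set" and \<iota> :: "nat \<Rightarrow> 'x" and e :: "nat \<Rightarrow> 'x \<Rightarrow> nat"
  assumes G: "group G" and R: "ring R" and fin: "i < r \<Longrightarrow> finite (A i)"
    and inj_\<iota>: "inj \<iota>" and e: "i < r \<Longrightarrow> bij_betw (e i) (A i) {..<card (A i)}"
begin

interpretation G: group G by (rule G)
interpretation R: ring R by (rule R)
interpretation FI: monic_category "FI G :: ('x set, ('x, 'g) gmap) category"
  by (rule monic_category_FI) (rule G)

abbreviation "std n \<equiv> \<iota> ` {..<n}"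

abbreviation "D \<equiv> direct_sum {..<r} (\<lambda>i. principal_projective (FI G) R (A i))"

abbreviation "label_group i \<equiv> product_group (A i) (\<lambda>_. G)"

definition monomials :: "nat \<Rightarrow> nat list set" where
  "monomials n = {i # vs | i vs. i < r \<and> length vs = card (A i) \<and> distinct vs \<and> set vs \<subseteq> {..<n}}"

definition embedding :: "nat list \<Rightarrow> 'x \<Rightarrow> 'x" where
  "embedding s = (\<lambda>a\<in>A (hd s). \<iota> (tl s ! e (hd s) a))"

definition coeff :: "nat list \<Rightarrow> (nat \<Rightarrow> ('x, 'g) gmap \<Rightarrow> 'k) \<Rightarrow> ('x \<Rightarrow> 'g) \<Rightarrow> 'k" where
  "coeff s u = curry (u (hd s)) (embedding s)"

definition relocate :: "(nat \<Rightarrow> nat) \<Rightarrow> nat \<Rightarrow> 'x \<Rightarrow> 'x" where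
  "relocate m n = (\<lambda>b\<in>std n. \<iota> (m (inv_into UNIV \<iota> b)))"

lemma inv_\<iota> [simp]: "inv_into UNIV \<iota> (\<iota> k) = k"
  by (rule inv_f_f[OF inj_\<iota>])

lemma \<iota>_eq [simp]: "\<iota> k = \<iota> l \<longleftrightarrow> k = l"
  using inj_\<iota> by (auto dest: injD)

lemma monomialsE:
  assumes "s \<in> monomials n"
  shows "s \<noteq> []" "hd s < r" "length (tl s) = card (A (hd s))" "distinct (tl s)"
    "set (tl s) \<subseteq> {..<n}" "finite (A (hd s))" "hd s # tl s = s"
    "a \<in> A (hd s) \<Longrightarrow> e (hd s) a < length (tl s)"
  using assms fin bij_betwE[OF e] by (auto simp: monomials_def)

lemma finite_monomials: "finite (monomials n)"
proof (rule finite_subset)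
  show "monomials n \<subseteq> (\<Union>i\<in>{..<r}. (#) i ` {vs. set vs \<subseteq> {..<n} \<and> length vs = card (A i)})"
    by (auto simp: monomials_def)
  show "finite (\<Union>i\<in>{..<r}. (#) i ` {vs. set vs \<subseteq> {..<n} \<and> length vs = card (A i)})"
    by (intro finite_UN_I finite_imageI finite_lists_length_eq) auto
qed

lemma embedding_mem:
  assumes s: "s \<in> monomials n"
  shows "embedding s \<in> A (hd s) \<rightarrow>\<^sub>E std n" and "inj_on (embedding s) (A (hd s))"
proof -
  have "tl s ! e (hd s) a \<in> {..<n}" if "a \<in> A (hd s)" for a
    using monomialsE(5)[OF s] monomialsE(8)[OF s that] nth_mem by blast
  then show "embedding s \<in> A (hd s) \<rightarrow>\<^sub>E std n"
    by (auto simp: embedding_def)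
  show "inj_on (embedding s) (A (hd s))"
  proof (rule inj_onI)
    fix a b assume ab: "a \<in> A (hd s)" "b \<in> A (hd s)" "embedding s a = embedding s b"
    then have "e (hd s) a = e (hd s) b"
      using monomialsE(4,8)[OF s] by (simp add: embedding_def nth_eq_iff_index_eq)
    then show "a = b"
      using e[OF monomialsE(2)[OF s]] ab(1,2) by (auto simp: bij_betw_def dest: inj_onD)
  qed
qed

lemma embedding_surj:
  assumes i: "i < r" and f: "f \<in> A i \<rightarrow>\<^sub>E std n" "inj_on f (A i)"
  obtains s where "s \<in> monomials n" "hd s = i" "embedding s = f"
proof
  let ?h = "inv_into (A i) (e i)" and ?v = "\<lambda>a. inv_into UNIV \<iota> (f a)"
  let ?vs = "map (\<lambda>j. ?v (?h j)) [0..<card (A i)]"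
  have h: "bij_betw ?h {..<card (A i)} (A i)"
    by (rule bij_betw_inv_into[OF e[OF i]])
  have v: "?v a < n" "\<iota> (?v a) = f a" if a: "a \<in> A i" for a
  proof -
    obtain k where "f a = \<iota> k" "k < n"
      using PiE_mem[OF f(1) a] by blast
    then show "?v a < n" "\<iota> (?v a) = f a" by simp_all
  qed
  have inj: "inj_on (\<lambda>j. ?v (?h j)) {..<card (A i)}"
  proof (rule inj_onI)
    fix j k assume jk: "j \<in> {..<card (A i)}" "k \<in> {..<card (A i)}" "?v (?h j) = ?v (?h k)"
    have mem: "?h j \<in> A i" "?h k \<in> A i"
      using bij_betw_apply[OF h] jk(1,2) by simp_all
    have "f (?h j) = f (?h k)" 
      by (rule arg_cong[OF jk(3), of \<iota>, unfolded v(2)[OF mem(1)] v(2)[OF mem(2)]])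
    then have "?h j = ?h k" by (rule inj_onD[OF f(2) _ mem])
    then show "j = k" by (rule inj_onD[OF bij_betw_imp_inj_on[OF h] _ jk(1,2)])
  qed
  show "i # ?vs \<in> monomials n"
  proof -
    have "distinct ?vs"
      using inj by (simp add: distinct_map atLeast0LessThan)
    moreover have "set ?vs \<subseteq> {..<n}"
      using v(1)[OF bij_betw_apply[OF h]] by auto
    ultimately show ?thesis
      unfolding monomials_def using i by simp
  qed
  show "hd (i # ?vs) = i" by simp
  show "embedding (i # ?vs) = f"
  proof (rule ext)
    fix a
    show "embedding (i # ?vs) a = f a"
    proof (cases "a \<in> A i")
      case True
      then have "e i a < card (A i)" "?h (e i a) = a"
        using bij_betwE[OF e[OF i]] bij_betw_inv_into_left[OF e[OF i]] by auto
      then show ?thesis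
        using True v(2)[OF True] by (simp add: embedding_def)
    next
      case False
      then show ?thesis
        using f(1) by (simp add: embedding_def PiE_def extensional_def)
    qed
  qed
qed

lemma embedding_inj:
  assumes s: "s \<in> monomials n" and t: "t \<in> monomials n'"
    and "hd s = hd t" and eq: "embedding s = embedding t"
  shows "s = t"
proof -
  let ?i = "hd s"
  note i = monomialsE(2)[OF s]
  have "tl s ! j = tl t ! j" if j: "j < card (A ?i)" for j
  proof -
    have "j \<in> e ?i ` A ?i"
      using bij_betw_imp_surj_on[OF e[OF i]] j by simp
    then obtain a where a: "a \<in> A ?i" "e ?i a = j" by blast
    then show ?thesis
      using fun_cong[OF eq, of a] \<open>hd s = hd t\<close> by (simp add: embedding_def)
  qed
  then have "tl s = tl t"
    using monomialsE(3)[OF s] monomialsE(3)[OF t] \<open>hd s = hd t\<close> by (intro nth_equalityI) auto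
  with \<open>hd s = hd t\<close> show ?thesis
    using monomialsE(1)[OF s] monomialsE(1)[OF t] by (simp add: list.expand)
qed

lemma shift_monomials:
  assumes s: "s \<in> monomials n" and m: "strict_mono m"
  shows "shift m s \<in> monomials (m n)"
proof -
  have "inj_on m (set (tl s))"
    using strict_mono_eq[OF m] by (simp add: inj_on_def)
  then have "shift m s \<in> {i # vs | i vs. i < r \<and> length vs = card (A i) \<and> distinct vs
      \<and> set vs \<subseteq> {..<m n}}"
    using monomialsE(2-5)[OF s] strict_mono_less[OF m]
    by (auto simp: shift_def distinct_map)
  then show ?thesis by (simp add: monomials_def)
qed

lemma embedding_shift:
  assumes s: "s \<in> monomials n"
  shows "embedding (shift m s) = (\<lambda>a\<in>A (hd s). relocate m n (embedding s a))"
proof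
  fix a
  show "embedding (shift m s) a = (\<lambda>a\<in>A (hd s). relocate m n (embedding s a)) a"
  proof (cases "a \<in> A (hd s)")
    case True
    then have "embedding s a \<in> std n"
      using embedding_mem(1)[OF s] by auto
    then show ?thesis
      using True monomialsE(8)[OF s True] by (simp add: embedding_def relocate_def shift_def)
  qed (simp add: embedding_def shift_def)
qed

lemma relocate_Arr:
  assumes m: "strict_mono m" and \<sigma>: "\<sigma> \<in> std n \<rightarrow>\<^sub>E carrier G"
  shows "(relocate m n, \<sigma>) \<in> Arr (FI G) (std n) (std (m n))"
  using \<sigma> strict_mono_less[OF m] strict_mono_eq[OF m]
  by (auto simp: relocate_def inj_on_def)

lemma D_component:
  assumes "u \<in> carrier (RepMod D B)" and "i < r"
  shows "u i \<in> carrier (free_module R (Arr (FI G) (A i) B))"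
  using assms by (auto simp: direct_sum_def principal_projective_def)

lemma D_map_component:
  assumes "i < r"
  shows "RepMap D B B' f u i = RepMap (principal_projective (FI G) R (A i)) B B' f (u i)"
  using assms by (simp add: direct_sum_def)

lemma representation_D: "representation (FI G) R D"
  using fin by (intro representation_direct_sum R category_FI G
      FI.representation_principal_projective) auto

context
  fixes m :: "nat \<Rightarrow> nat" and n :: nat and \<sigma> :: "'x \<Rightarrow> 'g" and u
  assumes m: "strict_mono m" and \<sigma>: "\<sigma> \<in> std n \<rightarrow>\<^sub>E carrier G"
    and u: "u \<in> carrier (RepMod D (std n))"
begin

lemma coeff_map_shift:
  assumes s: "s \<in> monomials n"
  shows "coeff (shift m s) (RepMap D (std n) (std (m n)) (relocate m n, \<sigma>) u)
    = left_translate R (label_group (hd s)) (\<lambda>a\<in>A (hd s). \<sigma> (embedding s a)) (coeff s u)"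
proof -
  have [simp]: "hd (shift m s) = hd s" by (simp add: shift_def)
  show ?thesis
    unfolding coeff_def embedding_shift[OF s] D_map_component[OF monomialsE(2)[OF s]] \<open>hd (shift m s) = hd s\<close>
    by (rule block_of_map[OF G R monomialsE(6)[OF s] _ _ relocate_Arr[OF m \<sigma>]
          D_component[OF u monomialsE(2)[OF s]] embedding_mem[OF s]]) simp_all
qed

text \<open>An injection that factors through a relocation is the embedding of a shifted monomial, and a
  monomial is determined by its embedding and summand; so \<open>t\<close> does not factor.\<close>

lemma coeff_map_not_shift:
  assumes t: "t \<in> monomials (m n)" and off: "t \<notin> shift m ` monomials n"
  shows "coeff t (RepMap D (std n) (std (m n)) (relocate m n, \<sigma>) u) = (\<lambda>_. \<zero>\<^bsub>R\<^esub>)"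
  unfolding coeff_def D_map_component[OF monomialsE(2)[OF t]]
proof (rule block_of_map_off_image[OF G R monomialsE(6)[OF t] _ _ relocate_Arr[OF m \<sigma>]
      D_component[OF u monomialsE(2)[OF t]]])
  fix f assume f: "f \<in> A (hd t) \<rightarrow>\<^sub>E std n" "inj_on f (A (hd t))"
  obtain s where s: "s \<in> monomials n" "hd s = hd t" "embedding s = f"
    by (rule embedding_surj[OF monomialsE(2)[OF t] f])
  show "embedding t \<noteq> (\<lambda>a\<in>A (hd t). relocate m n (f a))"
  proof
    assume "embedding t = (\<lambda>a\<in>A (hd t). relocate m n (f a))"
    then have "embedding t = embedding (shift m s)"
      using embedding_shift[OF s(1), of m] s(2,3) by simp
    then have "t = shift m s"
      using s(2) by (intro embedding_inj[OF t shift_monomials[OF s(1) m]]) (simp_all add: shift_def)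
    with off s(1) show False by blast
  qed
qed simp_all

end

lemma coeff_linear:
  assumes s: "s \<in> monomials n"
  shows "coeff s \<in> linear_maps R (RepMod D (std n)) (free_module R (carrier (label_group (hd s))))"
proof -
  note lin = linear_mapsD[OF block_linear[where R = R and G = G and A = "A (hd s)" and B = "std n"
        and f = "embedding s"]]
  note i = monomialsE(2)[OF s]
  show ?thesis
    unfolding linear_maps_def
  proof (intro CollectI conjI ballI Pi_I)
    fix u assume u: "u \<in> carrier (RepMod D (std n))"
    show "coeff s u \<in> carrier (free_module R (carrier (label_group (hd s))))"
      using lin(1)[OF D_component[OF u i]] by (simp add: coeff_def)
    show "coeff s (a \<odot>\<^bsub>RepMod D (std n)\<^esub> u)
        = a \<odot>\<^bsub>free_module R (carrier (label_group (hd s)))\<^esub> coeff s u" if "a \<in> carrier R" for a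
      using lin(3)[OF that D_component[OF u i]] i
      by (simp add: coeff_def direct_sum_def principal_projective_def)
    show "coeff s (u \<oplus>\<^bsub>RepMod D (std n)\<^esub> v)
        = coeff s u \<oplus>\<^bsub>free_module R (carrier (label_group (hd s)))\<^esub> coeff s v"
      if v: "v \<in> carrier (RepMod D (std n))" for v
      using lin(2)[OF D_component[OF u i] D_component[OF v i]] i
      by (simp add: coeff_def direct_sum_def principal_projective_def)
  qed
qed

lemma coeff_jointly_inj:
  assumes u: "u \<in> carrier (RepMod D (std n))"
    and zero: "\<forall>s\<in>monomials n. coeff s u = (\<lambda>_. \<zero>\<^bsub>R\<^esub>)"
  shows "u = \<zero>\<^bsub>RepMod D (std n)\<^esub>"
proof
  fix i
  show "u i = \<zero>\<^bsub>RepMod D (std n)\<^esub> i"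
  proof (cases "i < r")
    case True
    have "u i (f, \<rho>) = \<zero>\<^bsub>R\<^esub>" for f \<rho>
    proof (cases "(f, \<rho>) \<in> Arr (FI G) (A i) (std n)")
      case arr: True
      then have f: "f \<in> A i \<rightarrow>\<^sub>E std n" "inj_on f (A i)" by simp_all
      obtain s where "s \<in> monomials n" "hd s = i" "embedding s = f"
        by (rule embedding_surj[OF True f])
      then show ?thesis
        using fun_cong[OF bspec[OF zero], of s \<rho>] by (simp add: coeff_def)
    qed (rule free_moduleD(2)[OF D_component[OF u True]])
    then show ?thesis
      using True by (auto simp: direct_sum_def principal_projective_def free_module_def)
  next
    case False
    then show ?thesis
      using u by (simp add: direct_sum_def PiE_def extensional_def)
  qed
qed

abbreviation "leading N n \<equiv> leading_coefficients R (monomials n) coeff (N (std n))"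

text \<open>The order on monomials is compatible with shifts, and coefficients off the image of the shift
  vanish. So a morphism that shifts positions carries an element with leading monomial \<open>s\<close> to one
  whose leading monomial is the shift of \<open>s\<close>, and translates the leading coefficient.\<close>

lemma leading_map:
  assumes N: "subrepresentation (FI G) R D N" and m: "strict_mono m"
    and \<sigma>: "\<sigma> \<in> std n \<rightarrow>\<^sub>E carrier G" and s: "s \<in> monomials n" and c: "c \<in> leading N n s"
  shows "left_translate R (label_group (hd s)) (\<lambda>a\<in>A (hd s). \<sigma> (embedding s a)) c
    \<in> leading N (m n) (shift m s)"
proof -
  obtain u where u: "u \<in> N (std n)" "c = coeff s u"
    and top: "\<And>t. t \<in> monomials n \<Longrightarrow> s < t \<Longrightarrow> coeff t u = (\<lambda>_. \<zero>\<^bsub>R\<^esub>)"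
    using c by (auto simp: leading_coefficients_def)
  have uD: "u \<in> carrier (RepMod D (std n))"
    by (rule subrepresentationD(2)[OF N _ u(1)]) simp
  let ?u = "RepMap D (std n) (std (m n)) (relocate m n, \<sigma>) u"
  have "?u \<in> N (std (m n))"
    by (rule subrepresentationD(3)[OF N _ _ relocate_Arr[OF m \<sigma>] u(1)]) simp_all
  moreover have "coeff t ?u = (\<lambda>_. \<zero>\<^bsub>R\<^esub>)" if t: "t \<in> monomials (m n)" "shift m s < t" for t
  proof (cases "t \<in> shift m ` monomials n")
    case True
    then obtain t' where t': "t = shift m t'" "t' \<in> monomials n" by blast
    have "s < t'"
    proof (rule ccontr)
      assume "\<not> s < t'"
      then have "t' < s \<or> t' = s" by auto
      then have "t \<le> shift m s"
        using shift_less_shift[OF m monomialsE(1)[OF t'(2)] monomialsE(1)[OF s]] t'(1) by auto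
      with t(2) show False by simp
    qed
    then show ?thesis
      using coeff_map_shift[OF m \<sigma> uD t'(2)] top[OF t'(2)] t'(1) left_translate_zero by simp
  qed (rule coeff_map_not_shift[OF m \<sigma> uD t(1)])
  moreover have "left_translate R (label_group (hd s)) (\<lambda>a\<in>A (hd s). \<sigma> (embedding s a)) c
      = coeff (shift m s) ?u"
    using coeff_map_shift[OF m \<sigma> uD s] u(2) by simp
  ultimately show ?thesis
    unfolding leading_coefficients_def by blast
qed

lemma submodule_leading:
  assumes N: "subrepresentation (FI G) R D N" and s: "s \<in> monomials n"
  shows "submodule (leading N n s) R (free_module R (carrier (label_group (hd s))))"
proof -
  have sub: "submodule (N (std n)) R (RepMod D (std n))"
    using N by (simp add: subrepresentation_def)
  interpret F: left_module R "free_module R (carrier (label_group (hd s)))"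
    by (rule left_module_free_module[OF R])
  have Dmod: "left_module R (RepMod D (std n))"
    by (rule representationD(1)[OF representation_D]) simp
  note lin = linear_mapsD[OF coeff_linear] linear_map_zero[OF Dmod left_module_free_module[OF R] coeff_linear]
  have mem: "\<And>u. u \<in> N (std n) \<Longrightarrow> u \<in> carrier (RepMod D (std n))"
    using submoduleD(1)[OF sub] by blast
  have zero: "\<zero>\<^bsub>free_module R S\<^esub> = (\<lambda>_. \<zero>\<^bsub>R\<^esub>)" for S :: "('x \<Rightarrow> 'g) set"
    by (simp add: free_module_def)
  show ?thesis
  proof (rule F.submodule_intro)
    show "leading N n s \<subseteq> carrier (free_module R (carrier (label_group (hd s))))"
      using lin(1)[OF s mem] unfolding leading_coefficients_def by blast
    show "\<zero>\<^bsub>free_module R (carrier (label_group (hd s)))\<^esub> \<in> leading N n s"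
      unfolding leading_coefficients_def
      using submoduleD(2)[OF sub] lin(4)[OF s] lin(4)
      by (intro image_eqI[where x = "\<zero>\<^bsub>RepMod D (std n)\<^esub>"]) (auto simp: zero)
  next
    fix c d assume "c \<in> leading N n s" "d \<in> leading N n s"
    then obtain u v where u: "u \<in> N (std n)" "c = coeff s u"
        "\<And>t. t \<in> monomials n \<Longrightarrow> s < t \<Longrightarrow> coeff t u = (\<lambda>_. \<zero>\<^bsub>R\<^esub>)"
      and v: "v \<in> N (std n)" "d = coeff s v"
        "\<And>t. t \<in> monomials n \<Longrightarrow> s < t \<Longrightarrow> coeff t v = (\<lambda>_. \<zero>\<^bsub>R\<^esub>)"
      by (auto simp: leading_coefficients_def)
    have "coeff t (u \<oplus>\<^bsub>RepMod D (std n)\<^esub> v) = (\<lambda>_. \<zero>\<^bsub>R\<^esub>)" if "t \<in> monomials n" "s < t" for t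
      using lin(2)[OF that(1) mem[OF u(1)] mem[OF v(1)]] u(3)[OF that] v(3)[OF that]
      by (simp add: free_module_def)
    then show "c \<oplus>\<^bsub>free_module R (carrier (label_group (hd s)))\<^esub> d \<in> leading N n s"
      unfolding leading_coefficients_def
      using submoduleD(3)[OF sub u(1) v(1)] lin(2)[OF s mem[OF u(1)] mem[OF v(1)]] u(2) v(2)
      by (intro image_eqI[where x = "u \<oplus>\<^bsub>RepMod D (std n)\<^esub> v"]) auto
  next
    fix a c assume a: "a \<in> carrier R" and "c \<in> leading N n s"
    then obtain u where u: "u \<in> N (std n)" "c = coeff s u"
        "\<And>t. t \<in> monomials n \<Longrightarrow> s < t \<Longrightarrow> coeff t u = (\<lambda>_. \<zero>\<^bsub>R\<^esub>)"
      by (auto simp: leading_coefficients_def)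
    have "coeff t (a \<odot>\<^bsub>RepMod D (std n)\<^esub> u) = (\<lambda>_. \<zero>\<^bsub>R\<^esub>)" if "t \<in> monomials n" "s < t" for t
      using lin(3)[OF that(1) a mem[OF u(1)]] u(3)[OF that] a
      by (simp add: free_module_def)
    then show "a \<odot>\<^bsub>free_module R (carrier (label_group (hd s)))\<^esub> c \<in> leading N n s"
      unfolding leading_coefficients_def
      using submoduleD(4)[OF sub a u(1)] lin(3)[OF s a mem[OF u(1)]] u(2)
      by (intro image_eqI[where x = "a \<odot>\<^bsub>RepMod D (std n)\<^esub> u"]) auto
  qed
qed

text \<open>The translation by any labelling \<open>p\<close> of \<open>A (hd s)\<close> comes from an automorphism that fixes
  all positions: as the embedding is injective, \<open>p\<close> can be spread over its image, with trivial labels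
  elsewhere.\<close>

lemma left_ideal_leading:
  assumes N: "subrepresentation (FI G) R D N" and s: "s \<in> monomials n"
  shows "left_ideal (leading N n s) (group_algebra R (label_group (hd s)))"
proof -
  have "left_translate R (label_group (hd s)) p c \<in> leading N n s"
    if p: "p \<in> carrier (label_group (hd s))" and c: "c \<in> leading N n s" for p c
  proof -
    let ?f = "embedding s" and ?A = "A (hd s)"
    define \<sigma> where "\<sigma> = (\<lambda>b\<in>std n. if b \<in> ?f ` ?A then p (inv_into ?A ?f b) else \<one>\<^bsub>G\<^esub>)"
    have \<sigma>: "\<sigma> \<in> std n \<rightarrow>\<^sub>E carrier G"
      using p by (auto simp: \<sigma>_def PiE_def Pi_def inv_into_into)
    have "(\<lambda>a\<in>?A. \<sigma> (?f a)) = p"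
    proof
      fix a
      show "(\<lambda>a\<in>?A. \<sigma> (?f a)) a = p a"
      proof (cases "a \<in> ?A")
        case True
        then have "?f a \<in> std n" using embedding_mem(1)[OF s] by auto
        with True show ?thesis
          using embedding_mem(2)[OF s] by (simp add: \<sigma>_def)
      next
        case False
        then show ?thesis using p by (simp add: PiE_def extensional_def)
      qed
    qed
    moreover have "shift (\<lambda>k. k) s = s"
      using monomialsE(7)[OF s] by (simp add: shift_def)
    ultimately show ?thesis
      using leading_map[OF N _ \<sigma> s c, of "\<lambda>k. k"] by (simp add: strict_mono_def)
  qed
  moreover have "group (label_group (hd s))" using G by simp
  ultimately show ?thesis
    using left_ideal_group_algebra_iff[OF R] submodule_leading[OF N s] by blast
qed

text \<open>The morphism with trivial labels does not translate.\<close>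

lemma leading_shift:
  assumes N: "subrepresentation (FI G) R D N" and m: "strict_mono m" and s: "s \<in> monomials n"
  shows "leading N n s \<subseteq> leading N (m n) (shift m s)"
proof
  fix c assume c: "c \<in> leading N n s"
  let ?\<sigma> = "\<lambda>b\<in>std n. \<one>\<^bsub>G\<^esub>"
  have \<sigma>: "?\<sigma> \<in> std n \<rightarrow>\<^sub>E carrier G" by simp
  have "(\<lambda>a\<in>A (hd s). ?\<sigma> (embedding s a)) = \<one>\<^bsub>label_group (hd s)\<^esub>"
    by (rule ext) (simp add: PiE_mem[OF embedding_mem(1)[OF s]] restrict_def)
  moreover have "left_translate R (label_group (hd s)) \<one>\<^bsub>label_group (hd s)\<^esub> c = c"
  proof -
    have c': "c \<in> carrier (free_module R (carrier (label_group (hd s))))"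
      using c submoduleD(1)[OF submodule_leading[OF N s]] by blast
    show ?thesis
      by (rule left_translate_one[OF _ c']) (use G in simp)
  qed
  ultimately show "c \<in> leading N (m n) (shift m s)"
    using leading_map[OF N m \<sigma> s c] by simp
qed

text \<open>Suppose that leading coefficients jump at infinitely many stages \<open>q j\<close> of the chain, at the monomials
  \<open>s j\<close>. After passing to a subsequence every monomial is a shift of the preceding ones; the left
  ideals \<open>J j\<close> of leading coefficients at stage \<open>q j\<close> and monomial \<open>s j\<close> then ascend. Since
  \<open>J (j + 1)\<close> belongs to a stage after the jump at \<open>q j\<close>, it also contains the larger ideal that
  appears by that jump, so that \<open>J\<close> never becomes stationary. Hence there are finitely many jumps, and
  the chain is constant after the last one.\<close>

lemma noetherian_rep_D:
  assumes noeth: "\<And>i. i < r \<Longrightarrow> left_noetherian (group_algebra R (label_group i))"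
  shows "noetherian_rep (FI G) R D"
  unfolding noetherian_rep_def
proof (intro allI impI)
  fix N :: "nat \<Rightarrow> 'x set \<Rightarrow> (nat \<Rightarrow> ('x, 'g) gmap \<Rightarrow> 'k) set"
  assume chain: "(\<forall>i. subrepresentation (FI G) R D (N i)) \<and>
    (\<forall>i. \<forall>B\<in>Obj (FI G). N i B \<subseteq> N (Suc i) B)"
  then have N: "subrepresentation (FI G) R D (N i)" for i by blast
  have mono: "N i B \<subseteq> N j B" if "i \<le> j" "finite B" for i j B
    by (rule lift_Suc_mono_le[of "\<lambda>i. N i B"]) (use chain that in auto)
  define jumps where "jumps = {k. \<exists>n. \<exists>s\<in>monomials n. \<not> leading (N (Suc k)) n s \<subseteq> leading (N k) n s}"
  have "finite jumps"
  proof (rule ccontr)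
    assume "infinite jumps"
    then obtain q :: "nat \<Rightarrow> nat" where q: "strict_mono q" "\<And>j. q j \<in> jumps"
      using infinite_enumerate by blast
    then have "\<exists>n s. s \<in> monomials n \<and> \<not> leading (N (Suc (q j))) n s \<subseteq> leading (N (q j)) n s" for j
      unfolding jumps_def by blast
    then obtain n s where s: "\<And>j. s j \<in> monomials (n j)"
      and jump: "\<And>j. \<not> leading (N (Suc (q j))) (n j) (s j) \<subseteq> leading (N (q j)) (n j) (s j)"
      by metis
    have "length (s j) = Suc (card (A (hd (s j))))" for j
      using monomialsE(1,3)[OF s[of j]] by (cases "s j") auto
    from monomials_wqo[of s r "\<lambda>i. card (A i)" n, OF monomialsE(2)[OF s] this monomialsE(4)[OF s] monomialsE(5)[OF s]]
    obtain h :: "nat \<Rightarrow> nat" where h: "strict_mono h" and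
      wqo: "\<And>j k. j \<le> k \<Longrightarrow> \<exists>m. strict_mono m \<and> m (n (h j)) = n (h k) \<and> s (h k) = shift m (s (h j))"
      by blast
    define J where "J = (\<lambda>j. leading (N (q (h j))) (n (h j)) (s (h j)))"
    have hd_eq: "hd (s (h j)) = hd (s (h 0))" for j
      using wqo[of 0 j] by (auto simp: shift_def)
    have step: "leading (N k) (n (h j)) (s (h j)) \<subseteq> J (Suc j)" if "k \<le> q (h (Suc j))" for k j
    proof -
      obtain m where m: "strict_mono m" "m (n (h j)) = n (h (Suc j))" "s (h (Suc j)) = shift m (s (h j))"
        using wqo[of j "Suc j"] by auto
      have "leading (N k) (n (h j)) (s (h j)) \<subseteq> leading (N k) (n (h (Suc j))) (s (h (Suc j)))"
        using leading_shift[OF N[of k] m(1) s[of "h j"]] m(2,3) by simp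
      also have "\<dots> \<subseteq> J (Suc j)"
        using mono[OF that] unfolding J_def leading_coefficients_def by blast
      finally show ?thesis .
    qed
    have lt: "q (h j) < q (h (Suc j))" for j
      using q(1) h by (simp add: strict_mono_def)
    have "left_ideal (J j) (group_algebra R (label_group (hd (s (h 0)))))" for j
      using left_ideal_leading[OF N[of "q (h j)"] s[of "h j"]] hd_eq[of j] by (simp add: J_def)
    moreover have "J j \<subseteq> J (Suc j)" for j
      using step[of "q (h j)" j] lt[of j] unfolding J_def by simp
    ultimately have "\<exists>j. \<forall>k\<ge>j. J k = J j"
      using noeth[OF monomialsE(2)[OF s[of "h 0"]]] unfolding left_noetherian_def by blast
    then obtain j where "J (Suc j) = J j" by (meson le_SucI order_refl)
    moreover have "leading (N (Suc (q (h j)))) (n (h j)) (s (h j)) \<subseteq> J (Suc j)"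
      using step lt[of j] by simp
    ultimately show False
      using jump[of "h j"] by (simp add: J_def)
  qed
  then obtain K where K: "\<forall>k\<in>jumps. k < K"
    unfolding finite_nat_set_iff_bounded ..
  have step: "N (Suc k) B = N k B" if "K \<le> k" and B: "finite B" for k B
  proof -
    let ?n = "card B"
    have "N (Suc k) (std ?n) = N k (std ?n)"
    proof (rule leading_coefficients_determine_submodule[OF _ _ _ _ finite_monomials coeff_linear
            coeff_jointly_inj])
      show "left_module R (RepMod D (std ?n))"
        by (rule representationD(1)[OF representation_D]) simp
      show "submodule (N k (std ?n)) R (RepMod D (std ?n))"
        "submodule (N (Suc k) (std ?n)) R (RepMod D (std ?n))"
        using N by (simp_all add: subrepresentation_def)
      show "N k (std ?n) \<subseteq> N (Suc k) (std ?n)" by (rule mono) simp_all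
      show "leading (N (Suc k)) ?n s \<subseteq> leading (N k) ?n s" if "s \<in> monomials ?n" for s
      proof (rule ccontr)
        assume "\<not> ?thesis"
        with that have "k \<in> jumps" unfolding jumps_def by blast
        with K \<open>K \<le> k\<close> show False by fastforce
      qed
    qed
    note eq = this
    have "\<exists>h. bij_betw h B (std ?n)"
      using B inj_\<iota> by (intro finite_same_card_bij) (simp_all add: card_image inj_on_subset)
    then obtain h where h: "bij_betw h B (std ?n)" by blast
    obtain f g where f: "f \<in> Arr (FI G) B (std ?n)" and g: "g \<in> Arr (FI G) (std ?n) B"
      and gf: "Comp (FI G) B (std ?n) B g f = Ident (FI G) B"
      by (rule FI_iso[OF G B h])
    show ?thesis
      by (rule subrepresentation_eq_at_iso[OF representation_D N N _ _ f g gf eq]) (simp_all add: B)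
  qed
  have stable: "N m B = N K B" if "K \<le> m" "finite B" for m B
    using that(1) by (induction m rule: dec_induct) (use step that(2) in auto)
  show "\<exists>n. \<forall>m\<ge>n. \<forall>B\<in>Obj (FI G). N m B = N n B"
    by (intro exI[where x = K] allI impI ballI stable) simp_all
qed

end

theorem theorem1p2p1:
  fixes G :: "('g, 'b) monoid_scheme"
    and R :: "('k, 'c) ring_scheme"
  assumes "group G"
    and "ring R"
    and "\<one>\<^bsub>R\<^esub> \<noteq> \<zero>\<^bsub>R\<^esub>"
    and "infinite (UNIV :: 'x set)"
    and "\<exists>e :: (nat \<Rightarrow> ('x, 'g) gmap \<Rightarrow> 'k) \<Rightarrow> 'm. inj e"
  shows "noetherian_Rep TYPE('m) (FI G :: ('x set, ('x, 'g) gmap) category) R \<longleftrightarrow>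
    (\<forall>n::nat. left_noetherian (group_algebra R (product_group {..<n} (\<lambda>_. G))))"
proof -
  let ?C = "FI G :: ('x set, ('x, 'g) gmap) category"
  let ?P = "principal_projective ?C R"
  interpret G: group G by fact
  interpret FI: monic_category ?C
    by (rule monic_category_FI) fact
  note C = category_FI[OF \<open>group G\<close>]
  note P = FI.representation_principal_projective[OF \<open>ring R\<close>]
  obtain e :: "(nat \<Rightarrow> ('x, 'g) gmap \<Rightarrow> 'k) \<Rightarrow> 'm" where "inj e"
    using assms(5) by blast
  have transfer: "left_noetherian (group_algebra R (product_group A (\<lambda>_. G)))
      \<longleftrightarrow> left_noetherian (group_algebra R (product_group {..<card A} (\<lambda>_. G)))"
    if A: "finite A" for A :: "'x set"
  proof -
    obtain b where b: "bij_betw b A {..<card A}"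
      using ex_bij_betw_finite_nat[OF A] by (auto simp: atLeast0LessThan)
    have gA: "group (product_group A (\<lambda>_. G))" "group (product_group {..<card A} (\<lambda>_. G))"
      using \<open>group G\<close> by simp_all
    show ?thesis
      using left_noetherian_group_algebra_iso[OF \<open>ring R\<close> gA product_group_reindex_iso[OF bij_betw_inv_into[OF b]]]
        left_noetherian_group_algebra_iso[OF \<open>ring R\<close> gA(2,1) product_group_reindex_iso[OF b]]
      by blast
  qed
  have sums_iff: "noetherian_Rep TYPE('m) ?C R \<longleftrightarrow>
      (\<forall>(n::nat) A. (\<forall>i<n. A i \<in> Obj ?C) \<longrightarrow>
        noetherian_rep ?C R (direct_sum {..<n} (\<lambda>i. ?P (A i))))"
    by (rule noetherian_Rep_iff_sums[OF \<open>ring R\<close> C \<open>inj e\<close> P])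
  show ?thesis
  proof (intro iffI allI)
    fix n :: nat
    assume sums: "noetherian_Rep TYPE('m) ?C R"
    obtain A :: "'x set" where A: "finite A" "card A = n"
      using infinite_arbitrarily_large[OF assms(4)] by blast
    \<comment> \<open>A single principal projective is a quotient of the sum with one term.\<close>
    let ?D = "direct_sum {..<1::nat} (\<lambda>i. ?P A)"
    have D: "representation ?C R ?D"
      using A by (intro representation_direct_sum assms C P) simp_all
    have quot: "is_quotient_of ?C R (?P A) ?D"
      unfolding is_quotient_of_def
    proof (intro bexI ballI)
      show "(\<lambda>_ u. u 0) \<in> natural_transformations ?C R ?D (?P A)"
        by (auto simp: natural_transformations_def linear_maps_def direct_sum_def)
      fix B
      show "(\<lambda>u. u 0) ` carrier (RepMod ?D B) = carrier (RepMod (?P A) B)"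
      proof
        show "carrier (RepMod (?P A) B) \<subseteq> (\<lambda>u. u 0) ` carrier (RepMod ?D B)"
        proof
          fix \<phi> assume "\<phi> \<in> carrier (RepMod (?P A) B)"
          then show "\<phi> \<in> (\<lambda>u. u 0) ` carrier (RepMod ?D B)"
            by (intro image_eqI[where x = "\<lambda>i\<in>{..<1}. \<phi>"]) (auto simp: direct_sum_def)
        qed
      qed (auto simp: direct_sum_def)
    qed
    have "noetherian_rep ?C R ?D"
      using sums[unfolded sums_iff, rule_format, of 1 "\<lambda>_. A"] A by simp
    then have "noetherian_rep ?C R (?P A)"
      using A by (intro noetherian_rep_quotient[OF D P quot]) simp_all
    then have "left_noetherian (group_algebra R (product_group A (\<lambda>_. G)))"
      by (rule left_noetherian_of_principal_projective[OF assms(1,2) A(1)])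
    then show "left_noetherian (group_algebra R (product_group {..<n} (\<lambda>_. G)))"
      using transfer[OF A(1)] A(2) by simp
  next
    assume noeth: "\<forall>n::nat. left_noetherian (group_algebra R (product_group {..<n} (\<lambda>_. G)))"
    show "noetherian_Rep TYPE('m) ?C R"
      unfolding sums_iff
    proof (intro allI impI)
      fix r :: nat and A :: "nat \<Rightarrow> 'x set"
      assume A: "\<forall>i<r. A i \<in> Obj ?C"
      obtain \<iota> :: "nat \<Rightarrow> 'x" where "inj \<iota>"
        using infinite_countable_subset[OF assms(4)] by blast
      have "\<exists>b. bij_betw b (A i) {..<card (A i)}" if "i < r" for i
        using A that ex_bij_betw_finite_nat[of "A i"] by (auto simp: atLeast0LessThan)
      then obtain b where "\<And>i. i < r \<Longrightarrow> bij_betw (b i) (A i) {..<card (A i)}" by metis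
      then interpret FI_free_rep G R r A \<iota> b
        using A \<open>inj \<iota>\<close> assms(1,2) by (intro FI_free_rep.intro) simp_all
      show "noetherian_rep ?C R (direct_sum {..<r} (\<lambda>i. ?P (A i)))"
        using noeth A by (intro noetherian_rep_D) (simp add: transfer)
    qed
  qed
qed

end
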